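(* Let $\nu>0$ and let $J_\nu$ be the Bessel function of the first kind of order $\nu$. The function $$z\mapsto 2^{\nu}\Gamma(\nu)z^{\frac{3}{2}-\frac{\nu}{2}}J_{\nu}'(\sqrt{z})$$ is starlike in $\mathbb{D}$ and all of its derivatives are close-to-convex (and hence univalent) in $\mathbb{D}$ if and only if $\nu\geq\dot{\nu}$, where $\dot{\nu}\simeq0.7022\dots$ is the unique root on $(0,\infty)$ of the equation (in the unknown $\nu$) $$(2\nu-1)J_{\nu}(1)+(\nu-2)J_{\nu+1}(1)=0.$$
   Context: $\mathbb{D}=\{z\in\mathbb{C}:|z|<1\}$ is the open unit disk. The Bessel function of the first kind is $J_\nu(z)=\sum_{n\ge0}\frac{(-1)^n}{n!\,\Gamma(n+\nu+1)}\left(\frac z2\right)^{2n+\nu}$, and $J_\nu'$ is its derivative with respect to $z$; $J_\nu'(\sqrt z)$ means $J_\nu'$ evaluated at $\sqrt z$. The displayed function is understood as the entire function of $z$ given by its power series (the fractional powers cancel), which has the form $z+O(z^2)$ at $0$. An analytic function $f$ on $\mathbb{D}$ with $f(0)=0$ is starlike in $\mathbb{D}$ if it is univalent there and $f(\mathbb{D})$ is starlike with respect to the origin. An analytic function $h$ on $\mathbb{D}$ (not necessarily normalized) is close-to-convex in $\mathbb{D}$ if there is a univalent function $\varphi$ on $\mathbb{D}$ with convex image such that $\operatorname{Re}(h'(z)/\varphi'(z))>0$ for all $z\in\mathbb{D}$.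
   Formalization: The digits 0.7022… of the root are not correct (the root of the displayed equation is about 0.7019); the approximate value is stated instead as: the root differs from 0.7022 by less than 0.0005. *)

theory Defs
  imports "HOL-Analysis.Analysis"
begin

abbreviation unit_disk :: "complex set" ("\<D>") where
  "\<D> \<equiv> ball 0 1"

text \<open>
  The Bessel function of the first kind, with the principal branch of the power on every term.
  Since \<open>0 powr a = 0\<close> for all \<open>a\<close>, the value at \<open>z = 0\<close> is the intended one for \<open>\<nu> > 0\<close>,
  but not for \<open>\<nu> = 0\<close>.
\<close>

definition bessel_J :: "real \<Rightarrow> complex \<Rightarrow> complex" where
  "bessel_J \<nu> z =
     (\<Sum>n. of_real ((-1) ^ n / (fact n * Gamma (real n + \<nu> + 1)))
          * (z / 2) powr of_real (2 * real n + \<nu>))"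

text \<open>
  With principal branches the fractional powers cancel for every \<open>z \<noteq> 0\<close>, also on the negative
  real axis (where \<open>csqrt z\<close> is a positive multiple of \<open>\<i>\<close>), and at \<open>0\<close> both the product below
  and its power series vanish.  So the formula denotes the entire function given by that power
  series on all of the complex plane; see \<open>bessel_deriv_fun_sums\<close>.
\<close>

definition bessel_deriv_fun :: "real \<Rightarrow> complex \<Rightarrow> complex" where
  "bessel_deriv_fun \<nu> z =
     of_real (2 powr \<nu> * Gamma \<nu>) * z powr of_real (3 / 2 - \<nu> / 2) * deriv (bessel_J \<nu>) (csqrt z)"

definition starlike_fun :: "(complex \<Rightarrow> complex) \<Rightarrow> bool" where
  "starlike_fun f \<longleftrightarrow>
     f holomorphic_on \<D> \<and> f 0 = 0 \<and> inj_on f \<D> \<and>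
     (\<forall>w \<in> f ` \<D>. closed_segment 0 w \<subseteq> f ` \<D>)"

definition close_to_convex :: "(complex \<Rightarrow> complex) \<Rightarrow> bool" where
  "close_to_convex h \<longleftrightarrow>
     h holomorphic_on \<D> \<and>
     (\<exists>\<phi>. \<phi> holomorphic_on \<D> \<and> inj_on \<phi> \<D> \<and> convex (\<phi> ` \<D>) \<and>
          (\<forall>z \<in> \<D>. Re (deriv h z / deriv \<phi> z) > 0))"

definition bessel_coeff :: "real \<Rightarrow> nat \<Rightarrow> complex" where
  "bessel_coeff \<nu> n = of_real ((-1) ^ n / (fact n * Gamma (real n + \<nu> + 1)))"

lemma bessel_coeff_Suc:
  assumes "\<nu> > 0"
  shows "bessel_coeff \<nu> (Suc n) = - bessel_coeff \<nu> n / of_real ((real n + 1) * (real n + \<nu> + 1))"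
proof -
  have p: "real n + \<nu> + 1 > 0" using assms by simp
  have "Gamma (real (Suc n) + \<nu> + 1) = (real n + \<nu> + 1) * Gamma (real n + \<nu> + 1)"
  proof -
    have "real n + \<nu> + 1 \<notin> \<int>\<^sub>\<le>\<^sub>0"
      using p by (meson nonpos_Ints_nonpos not_le)
    from Gamma_plus1[OF this] show ?thesis by (simp add: add_ac)
  qed
  then have "(-1) ^ Suc n / (fact (Suc n) * Gamma (real (Suc n) + \<nu> + 1)) =
      - ((-1) ^ n / (fact n * Gamma (real n + \<nu> + 1))) / ((real n + 1) * (real n + \<nu> + 1))"
    by (simp add: mult_ac add_ac)
  then show ?thesis
    unfolding bessel_coeff_def by (simp only: of_real_minus of_real_divide)
qed

lemma summable_bessel_coeff:
  assumes "\<nu> > 0"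
  shows "summable (\<lambda>n. bessel_coeff \<nu> n * y ^ n)"
proof (rule summable_ratio_test[of "1/2" "nat \<lceil>2 * norm y\<rceil>"])
  fix n assume "nat \<lceil>2 * norm y\<rceil> \<le> n"
  then have n: "2 * norm y \<le> real n" by linarith
  have le': "real n * 1 \<le> (real n + 1) * (real n + \<nu> + 1)"
    using assms by (intro mult_mono) auto
  have le: "norm y / ((real n + 1) * (real n + \<nu> + 1)) \<le> 1 / 2"
  proof -
    have "norm y \<le> 1 / 2 * ((real n + 1) * (real n + \<nu> + 1))"
      using le' n by linarith
    moreover have "0 < (real n + 1) * (real n + \<nu> + 1)"
      using assms by (intro mult_pos_pos) auto
    ultimately show ?thesis by (subst pos_divide_le_eq)
  qed
  have "norm (bessel_coeff \<nu> (Suc n) * y ^ Suc n) =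
      norm (bessel_coeff \<nu> n * y ^ n) * (norm y / ((real n + 1) * (real n + \<nu> + 1)))"
    using assms by (simp add: bessel_coeff_Suc norm_mult norm_divide norm_power
        del: of_real_mult of_real_add)
  also have "\<dots> \<le> norm (bessel_coeff \<nu> n * y ^ n) * (1 / 2)"
    by (intro mult_left_mono le) auto
  finally show "norm (bessel_coeff \<nu> (Suc n) * y ^ Suc n) \<le> 1/2 * norm (bessel_coeff \<nu> n * y ^ n)"
    by (simp add: mult.commute)
qed simp

lemma bessel_J_eq:
  assumes "\<nu> > 0" "z \<noteq> 0"
  shows "bessel_J \<nu> z = (z / 2) powr of_real \<nu> * (\<Sum>n. bessel_coeff \<nu> n * ((z / 2)\<^sup>2) ^ n)"
proof -
  have "(z / 2) powr of_real (2 * real n + \<nu>) = (z / 2) powr of_real \<nu> * ((z / 2)\<^sup>2) ^ n" for n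
  proof -
    have "(z / 2) powr of_real (2 * real n + \<nu>) =
        (z / 2) powr of_real \<nu> * (z / 2) powr of_nat (2 * n)"
      by (simp add: powr_add[symmetric] add.commute)
    then show ?thesis
      using assms(2) by (simp only: powr_nat power_mult) simp
  qed
  then have "bessel_J \<nu> z =
      (\<Sum>n. (z / 2) powr of_real \<nu> * (bessel_coeff \<nu> n * ((z / 2)\<^sup>2) ^ n))"
    unfolding bessel_J_def bessel_coeff_def[symmetric] by (simp add: mult_ac)
  also have "\<dots> = (z / 2) powr of_real \<nu> * (\<Sum>n. bessel_coeff \<nu> n * ((z / 2)\<^sup>2) ^ n)"
    by (intro suminf_mult summable_bessel_coeff assms)
  finally show ?thesis .
qed

lemma deriv_bessel_J_sums:
  assumes "\<nu> > 0" "z \<notin> \<real>\<^sub>\<le>\<^sub>0"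
  shows "(\<lambda>n. (z / 2) powr of_real (\<nu> - 1) * (of_real ((2 * real n + \<nu>) / 2) *
            (bessel_coeff \<nu> n * ((z / 2)\<^sup>2) ^ n))) sums deriv (bessel_J \<nu>) z"
proof -
  have z: "z \<noteq> 0" and z2: "z / 2 \<notin> \<real>\<^sub>\<le>\<^sub>0"
    using assms(2) by (auto simp: complex_nonpos_Reals_iff)
  define y where "y = (z / 2)\<^sup>2"
  define A where "A = (\<lambda>x. \<Sum>n. bessel_coeff \<nu> n * x ^ n)"
  define B where "B = (\<Sum>n. diffs (bessel_coeff \<nu>) n * y ^ n)"
  have sA: "(\<lambda>n. bessel_coeff \<nu> n * y ^ n) sums A y"
    unfolding A_def by (intro summable_sums summable_bessel_coeff assms)
  have sd: "summable (\<lambda>n. diffs (bessel_coeff \<nu>) n * y ^ n)"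
    by (intro termdiff_converges_all summable_bessel_coeff assms)
  have "(\<lambda>n. of_nat n * bessel_coeff \<nu> n * y ^ (n - Suc 0)) sums B"
    unfolding B_def by (rule diffs_equiv[OF sd])
  from sums_mult[OF this, of y]
  have sB: "(\<lambda>n. of_nat n * (bessel_coeff \<nu> n * y ^ n)) sums (y * B)"
  proof (rule sums_cong[THEN iffD1, rotated])
    fix n show "y * (of_nat n * bessel_coeff \<nu> n * y ^ (n - Suc 0)) =
        of_nat n * (bessel_coeff \<nu> n * y ^ n)"
      by (cases n) auto
  qed
  have dA: "(A has_field_derivative B) (at y)"
    unfolding A_def B_def
    by (intro termdiffs_strong_converges_everywhere summable_bessel_coeff assms)
  have dy: "((\<lambda>z::complex. (z / 2)\<^sup>2) has_field_derivative z / 2) (at z)"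
    by (auto intro!: derivative_eq_intros simp: power2_eq_square)
  have dAy: "((\<lambda>z. A ((z / 2)\<^sup>2)) has_field_derivative B * (z / 2)) (at z)"
    using DERIV_chain2[OF dA[unfolded y_def] dy] .
  have dp: "((\<lambda>z. (z / 2) powr of_real \<nu>) has_field_derivative
      of_real \<nu> * (z / 2) powr (of_real \<nu> - 1) * (1 / 2)) (at z)"
    using z2 by (auto intro!: derivative_eq_intros)
  have pw: "(z / 2) powr of_real \<nu> = (z / 2) powr (of_real \<nu> - 1) * (z / 2)"
    using powr_add[of "z / 2" "of_real \<nu> - 1" 1] z by simp
  have "((\<lambda>z. (z / 2) powr of_real \<nu> * A ((z / 2)\<^sup>2)) has_field_derivative
      (z / 2) powr (of_real \<nu> - 1) * (of_real (\<nu> / 2) * A y + y * B)) (at z)"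
    by (rule DERIV_cong[OF DERIV_mult[OF dp dAy]])
       (simp add: pw y_def power2_eq_square algebra_simps)
  moreover have "\<forall>\<^sub>F x in nhds z. bessel_J \<nu> x = (x / 2) powr of_real \<nu> * A ((x / 2)\<^sup>2)"
  proof -
    have "\<forall>\<^sub>F x in nhds z. x \<in> - {0}"
      using z by (intro eventually_nhds_in_open) auto
    then show ?thesis
      by eventually_elim (simp add: bessel_J_eq[OF assms(1)] A_def)
  qed
  ultimately have "(bessel_J \<nu> has_field_derivative
      (z / 2) powr (of_real \<nu> - 1) * (of_real (\<nu> / 2) * A y + y * B)) (at z)"
    by (subst DERIV_cong_ev[OF refl _ refl])
  then have d: "deriv (bessel_J \<nu>) z =
      (z / 2) powr (of_real \<nu> - 1) * (of_real (\<nu> / 2) * A y + y * B)"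
    by (rule DERIV_imp_deriv)
  show ?thesis
    using sums_mult[OF sums_add[OF sums_mult[OF sA, of "of_real (\<nu> / 2)"] sB],
        of "(z / 2) powr (of_real \<nu> - 1)"]
    unfolding d y_def by (simp add: algebra_simps add_divide_distrib)
qed

lemma bessel_deriv_fun_sums:
  assumes "\<nu> > 0"
  shows "(\<lambda>n. of_real ((-1) ^ n * (2 * real n + \<nu>) * Gamma \<nu> /
              (4 ^ n * fact n * Gamma (real n + \<nu> + 1))) * z ^ Suc n)
           sums bessel_deriv_fun \<nu> z"
proof (cases "z = 0")
  case True
  then show ?thesis by (simp add: bessel_deriv_fun_def)
next
  case False
  have r: "csqrt z \<notin> \<real>\<^sub>\<le>\<^sub>0"
    using csqrt_principal[of z] False
    by (metis complex_nonpos_Reals_iff complex_eq_iff csqrt_eq_0 not_le order_less_le zero_complex.sel)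
  have half: "(csqrt z / 2) powr of_real (\<nu> - 1) =
      z powr of_real ((\<nu> - 1) / 2) / of_real (2 powr (\<nu> - 1))"
  proof -
    have "Ln (csqrt z / 2) = Ln (csqrt z) - of_real (ln 2)"
      using Ln_times_of_real[of "1/2" "csqrt z"] Ln_of_real[of "1/2"] False by (simp add: ln_div)
    moreover have "Ln (csqrt z) = Ln z / 2"
      using False Im_Ln_le_pi[of z] mpi_less_Im_Ln[of z] by (simp add: csqrt_exp_Ln)
    ultimately have L: "Ln (csqrt z / 2) = Ln z / 2 - of_real (ln 2)"
      by simp
    have "(csqrt z / 2) powr of_real (\<nu> - 1) = exp (of_real (\<nu> - 1) * Ln (csqrt z / 2))"
      using False by (simp add: powr_def)
    also have "of_real (\<nu> - 1) * Ln (csqrt z / 2) =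
        of_real ((\<nu> - 1) / 2) * Ln z - of_real ((\<nu> - 1) * ln 2)"
      unfolding L by (simp add: algebra_simps diff_divide_distrib)
    also have "exp \<dots> = exp (of_real ((\<nu> - 1) / 2) * Ln z) / of_real (exp ((\<nu> - 1) * ln 2))"
      by (simp only: exp_diff exp_of_real)
    finally show ?thesis
      using False by (simp add: powr_def)
  qed
  have pz: "z powr of_real (3 / 2 - \<nu> / 2) * z powr of_real ((\<nu> - 1) / 2) = z"
    using False by (simp add: diff_divide_distrib flip: powr_add)
  have p2: "2 powr \<nu> = 2 * 2 powr (\<nu> - 1 :: real)"
    by (simp add: powr_diff)
  have eq: "of_real (2 powr \<nu> * Gamma \<nu>) * z powr of_real (3 / 2 - \<nu> / 2) *
      ((csqrt z / 2) powr of_real (\<nu> - 1) * w) = of_real (2 * Gamma \<nu>) * z * w" for w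
  proof -
    have "of_real (2 powr \<nu> * Gamma \<nu>) * z powr of_real (3 / 2 - \<nu> / 2) *
        ((csqrt z / 2) powr of_real (\<nu> - 1) * w) =
        of_real (2 powr \<nu> / 2 powr (\<nu> - 1) * Gamma \<nu>) *
        (z powr of_real (3 / 2 - \<nu> / 2) * z powr of_real ((\<nu> - 1) / 2)) * w"
      unfolding half by simp
    then show ?thesis unfolding pz p2 by simp
  qed
  have t: "of_real (2 * Gamma \<nu>) * z *
      (of_real ((2 * real n + \<nu>) / 2) * (bessel_coeff \<nu> n * ((csqrt z / 2)\<^sup>2) ^ n)) =
      of_real ((-1) ^ n * (2 * real n + \<nu>) * Gamma \<nu> /
              (4 ^ n * fact n * Gamma (real n + \<nu> + 1))) * z ^ Suc n" for n
    by (simp add: bessel_coeff_def power_divide mult_ac)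
  from sums_mult[OF deriv_bessel_J_sums[OF assms r],
      of "of_real (2 powr \<nu> * Gamma \<nu>) * z powr of_real (3 / 2 - \<nu> / 2)"]
  show ?thesis unfolding eq t bessel_deriv_fun_def .
qed

end

theory Submission
  imports Defs "HOL-Complex_Analysis.Conformal_Mappings"
begin

text \<open>
  Write \<open>f\<close> for \<open>bessel_deriv_fun \<nu>\<close>.  Its Taylor series is
  \<open>f z = (\<Sum>n. (-1)^n * A n * z^(n + 1))\<close> with positive \<open>A n\<close>, and for every \<open>\<nu> > 0\<close> the
  \<open>A n\<close> decay fast: \<open>A (n + 1) \<le> A n / (4 * n * (n + 1))\<close> for \<open>n \<ge> 1\<close>.  So \<open>f\<close> is close to the
  polynomial \<open>z - A 1 * z^2\<close>, and that decides all the geometry.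

  Higher derivatives.  For \<open>k \<ge> 1\<close> the Taylor coefficients of the derivative of \<open>(deriv ^^ k) f\<close>
  decrease at least by the factor \<open>3/8\<close>.  This derivative therefore takes values in a half-plane
  when divided by its value at \<open>0\<close>, so that \<open>(deriv ^^ k) f\<close> is close-to-convex, with a linear
  comparison function, and univalent by the Noshiro-Warschawski theorem.  This holds for all
  \<open>\<nu> > 0\<close>.

  Starlikeness.  Because \<open>1 - Re (z^n)\<close> lies between \<open>0\<close> and \<open>n^2 * (1 - Re z)\<close> on the closed disk,
  the linear terms of \<open>f'\<close> and of \<open>f z / z\<close> outweigh all the later ones, in the sense that
  \<open>f' z \<approx> f' 1 + 2 * A 1 * (1 - z)\<close> and \<open>f z / z \<approx> f 1 + A 1 * (1 - z)\<close> with errors that are small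
  multiples of \<open>A 1 * \<bar>1 - z\<bar>\<close>.  If \<open>f' 1 \<ge> 0\<close>, this yields both \<open>Re (f' z) > 0\<close>, hence univalence,
  and \<open>Re (f' z * cnj (f z / z)) > 0\<close>, hence starlikeness.  If \<open>f' 1 < 0\<close>, then \<open>f'\<close>, which is real
  on the real axis and equal to \<open>1\<close> at \<open>0\<close>, vanishes somewhere in \<open>(0, 1)\<close>, and \<open>f\<close> is not even
  univalent (\<open>not_inj_if_slope_neg\<close>).  So \<open>f\<close> is starlike exactly if \<open>f' 1 \<ge> 0\<close>.

  The threshold.  As a function of \<open>\<nu>\<close>, the number \<open>f' 1\<close> (called \<open>slope_at_1 \<nu>\<close>) is continuous and
  strictly increasing, since the change of \<open>A 1\<close> outweighs the changes of all the later
  coefficients; it changes sign between \<open>0.7017\<close> and \<open>0.7027\<close>.  By Bessel's differential equation,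
  \<open>(2 * \<nu> - 1) * J_\<nu>(1) + (\<nu> - 2) * J_(\<nu>+1)(1)\<close> is a positive multiple of \<open>f' 1\<close>
  (\<open>bessel_equation_iff_slope_zero\<close>).
\<close>

section \<open>Univalence, starlikeness and close-to-convexity from sign conditions\<close>

text \<open>
  If \<open>f a = f b\<close>, the mean value theorem for the real part of \<open>f / (c * (b - a))\<close> on the segment
  from \<open>a\<close> to \<open>b\<close> produces a point where \<open>Re (f' / c)\<close> vanishes.
\<close>

lemma noshiro_warschawski:
  assumes "convex S"
    and der: "\<And>z. z \<in> S \<Longrightarrow> (f has_field_derivative f' z) (at z)"
    and pos: "\<And>z. z \<in> S \<Longrightarrow> 0 < Re (f' z / c)"
  shows "inj_on f S"
proof (rule inj_onI, rule ccontr)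
  fix a b assume ab: "a \<in> S" "b \<in> S" "f a = f b" "a \<noteq> b"
  have seg: "u \<in> S" if "u \<in> closed_segment a b" for u
    using that ab \<open>convex S\<close> closed_segment_subset by blast
  define g where "g = (\<lambda>u. f u / (c * (b - a)))"
  have "(g has_field_derivative f' u / (c * (b - a))) (at u)" if "u \<in> closed_segment a b" for u
    unfolding g_def by (intro DERIV_cdivide der seg that)
  from complex_mvt_line[of a b g, OF this] obtain u
    where u: "u \<in> closed_segment a b" and eq: "Re (g b) - Re (g a) = Re (f' u / (c * (b - a)) * (b - a))"
    by blast
  have "f' u / (c * (b - a)) * (b - a) = f' u / c"
    using ab by simp
  with eq ab have "Re (f' u / c) = 0" by (simp add: g_def)
  with pos[OF seg[OF u]] show False by simp
qed

text \<open>
  The hypothesis is the classical \<open>Re (z * f' z / f z) > 0\<close>, written without division by \<open>f\<close>.  It says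
  that the preimage of \<open>s * w\<close> has increasing modulus as \<open>s\<close> grows.  So, going from \<open>w = f z0\<close>
  towards the origin, the preimage stays in the compact disk of radius \<open>norm z0\<close> and the motion
  can always be continued.
\<close>

lemma starlike_criterion:
  assumes hol: "f holomorphic_on \<D>" and f0: "f 0 = 0" and inj: "inj_on f \<D>"
    and pos: "\<And>z. z \<in> \<D> \<Longrightarrow> z \<noteq> 0 \<Longrightarrow> 0 < Re (deriv f z * cnj (f z / z))"
  shows "starlike_fun f"
proof -
  obtain g where g_hol: "g holomorphic_on f ` \<D>"
    and g_deriv: "\<And>z. z \<in> \<D> \<Longrightarrow> deriv f z * deriv g (f z) = 1"
    and g_inv: "\<And>z. z \<in> \<D> \<Longrightarrow> g (f z) = z"
    using holomorphic_has_inverse[OF hol open_ball inj] by metis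
  have op: "open (f ` \<D>)"
    using open_mapping_thm3[OF hol open_ball inj] .
  have "of_real t * f z0 \<in> f ` \<D>" if z0: "z0 \<in> \<D>" and t: "0 \<le> t" "t \<le> 1" for z0 t
  proof -
    define w where "w = f z0"
    define K where "K = cball (0::complex) (norm z0)"
    define A where "A = {s \<in> {0..1}. of_real s * w \<in> f ` K}"
    have KD: "K \<subseteq> \<D>" using z0 by (auto simp: K_def)
    have "compact (f ` K)"
      using KD hol holomorphic_on_imp_continuous_on continuous_on_subset K_def
      by (metis compact_cball compact_continuous_image)
    moreover have "A = {0..1} \<inter> (\<lambda>s. of_real s * w) -` (f ` K)"
      by (auto simp: A_def)
    ultimately have closedA: "closed A"
      by (auto intro!: closed_Int closed_vimage continuous_intros simp: compact_imp_closed)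
    have one: "1 \<in> A" by (auto simp: A_def w_def K_def)
    \<comment> \<open>The preimage of \<open>s w\<close> moves inward as \<open>s\<close> decreases, so \<open>A\<close> is open to the left.\<close>
    have left: "\<exists>d>0. \<forall>h>0. h < d \<longrightarrow> h \<le> s \<longrightarrow> s - h \<in> A" if s: "s \<in> A" "0 < s" for s
    proof (cases "w = 0")
      case True
      then show ?thesis using s f0 by (auto simp: A_def K_def intro!: exI[of _ 1] image_eqI[of _ _ 0])
    next
      case False
      from s obtain z where z: "z \<in> K" "of_real s * w = f z" and s1: "s \<le> 1" by (auto simp: A_def)
      have zD: "z \<in> \<D>" using z KD by auto
      have z_nz: "z \<noteq> 0" using z False s f0 by auto
      have gz: "g (of_real s * w) = z" using g_inv[OF zD] z by simp
      have fd: "deriv f z \<noteq> 0" using g_deriv[OF zD] by auto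
      define \<gamma> where "\<gamma> = (\<lambda>r::real. g (of_real r * w))"
      have "(g has_field_derivative deriv g (f z)) (at (of_real s * w))"
        using holomorphic_derivI[OF g_hol op] zD z(2) by auto
      then have "(\<gamma> has_vector_derivative w * deriv g (f z)) (at s)"
        unfolding \<gamma>_def
        by (intro field_vector_diff_chain_at[unfolded o_def, where f = "\<lambda>r::real. of_real r * w"])
           (auto intro!: derivative_eq_intros)
      note d\<gamma> = this
      have "((\<lambda>r. Re (\<gamma> r)) has_real_derivative Re (w * deriv g (f z))) (at s)"
           "((\<lambda>r. Im (\<gamma> r)) has_real_derivative Im (w * deriv g (f z))) (at s)"
        using bounded_linear.has_vector_derivative[OF bounded_linear_Re d\<gamma>]
          bounded_linear.has_vector_derivative[OF bounded_linear_Im d\<gamma>]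
        by (simp_all add: has_real_derivative_iff_has_vector_derivative)
      note this[THEN DERIV_power, of 2]
      note d\<gamma>2 = DERIV_add[OF this]
      have \<gamma>s: "\<gamma> s = z" using gz by (simp add: \<gamma>_def)
      from d\<gamma>2 have "((\<lambda>r. (norm (\<gamma> r))\<^sup>2) has_real_derivative 2 * Re (w * deriv g (f z) * cnj z)) (at s)"
        (is "(_ has_real_derivative ?l) _")
        unfolding cmod_power2 by (rule DERIV_cong) (simp add: \<gamma>s algebra_simps)
      moreover have "?l > 0"
      proof -
        have dg: "deriv g (f z) = 1 / deriv f z" using g_deriv[OF zD] fd by (simp add: field_simps)
        have w: "w = f z / of_real s" using z(2) s(2) by (simp add: field_simps)
        have "w * deriv g (f z) * cnj z = (z * cnj z) / of_real s * (f z / z / deriv f z)"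
          using z_nz unfolding dg w by (simp add: field_simps)
        also have "\<dots> = of_real ((norm z)\<^sup>2 / (s * (norm (deriv f z))\<^sup>2)) * cnj (deriv f z * cnj (f z / z))"
          unfolding complex_div_cnj[of "f z / z"] complex_norm_square[symmetric] by (simp add: mult_ac)
        moreover have "Re (of_real r * cnj u) = r * Re u" for r u by simp
        ultimately have "Re (w * deriv g (f z) * cnj z)
            = (norm z)\<^sup>2 / (s * (norm (deriv f z))\<^sup>2) * Re (deriv f z * cnj (f z / z))"
          by (simp only:)
        moreover have "(norm z)\<^sup>2 / (s * (norm (deriv f z))\<^sup>2) > 0" using z_nz fd s(2) by simp
        then have "(norm z)\<^sup>2 / (s * (norm (deriv f z))\<^sup>2) * Re (deriv f z * cnj (f z / z)) > 0"
          using pos[OF zD z_nz] by (rule mult_pos_pos)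
        ultimately show ?thesis by (simp only: mult_pos_pos[OF zero_less_numeral])
      qed
      ultimately obtain d where d: "d > 0" "\<And>h. 0 < h \<Longrightarrow> h < d \<Longrightarrow> (norm (\<gamma> (s - h)))\<^sup>2 < (norm (\<gamma> s))\<^sup>2"
        using DERIV_pos_inc_left by blast
      have "open ((\<lambda>r::real. of_real r * w) -` (f ` \<D>))"
        by (intro open_vimage op continuous_intros)
      moreover have "s \<in> (\<lambda>r::real. of_real r * w) -` (f ` \<D>)" using z zD by auto
      ultimately obtain e where e: "e > 0" "ball s e \<subseteq> (\<lambda>r::real. of_real r * w) -` (f ` \<D>)"
        using open_contains_ball by blast
      show ?thesis
      proof (intro exI[of _ "min d e"] conjI allI impI)
        show "min d e > 0" using d e by simp
        fix h assume h: "0 < h" "h < min d e" "h \<le> s"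
        have "s - h \<in> ball s e" using h by (simp add: dist_real_def)
        with e obtain y where y: "y \<in> \<D>" "of_real (s - h) * w = f y" by blast
        have "\<gamma> (s - h) = y" using g_inv[OF y(1)] y(2) by (simp add: \<gamma>_def)
        with d(2)[of h] h have "(norm y)\<^sup>2 < (norm (\<gamma> s))\<^sup>2" by simp
        then have "norm y < norm z" unfolding \<gamma>s by (rule power2_less_imp_less) simp
        then have "y \<in> K" using z(1) by (simp add: K_def)
        then show "s - h \<in> A" using h s1 y(2) by (auto simp: A_def)
      qed
    qed
    have "t \<in> A"
    proof (rule ccontr)
      assume tA: "t \<notin> A"
      define B where "B = A \<inter> {t..}"
      have B: "closed B" "B \<noteq> {}" "bdd_below B"
        using closedA one t by (auto simp: B_def closed_Int intro!: bdd_belowI[of _ t])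
      define s where "s = Inf B"
      have sB: "s \<in> B" unfolding s_def using closed_contains_Inf[OF B(2,3,1)] .
      then have s: "s \<in> A" "t < s" using tA by (auto simp: B_def order_le_less)
      obtain d where d: "d > 0" "\<And>h. 0 < h \<Longrightarrow> h < d \<Longrightarrow> h \<le> s \<Longrightarrow> s - h \<in> A"
        using left[OF s(1)] s t by auto
      define h where "h = min (d / 2) (s - t)"
      have h: "h > 0" "h < d" "h \<le> s - t" using d s by (auto simp: h_def)
      have "s - h \<in> B" using d(2)[of h] h t by (auto simp: B_def)
      then have "s \<le> s - h" unfolding s_def using B(3) by (intro cInf_lower)
      with h show False by simp
    qed
    then show ?thesis using KD by (auto simp: A_def w_def)
  qed
  then have "closed_segment 0 w \<subseteq> f ` \<D>" if "w \<in> f ` \<D>" for w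
    using that by (auto simp: closed_segment_def scaleR_conv_of_real)
  then show ?thesis using assms by (auto simp: starlike_fun_def)
qed

section \<open>Power series governed by their linear term\<close>

text \<open>
  On the unit circle \<open>2 * (1 - Re w) = (norm (1 - w))^2\<close>, and the upper bound is the square of
  \<open>norm (1 - z^n) \<le> n * norm (1 - z)\<close>.  Inside the disk the additional term \<open>1 - (norm w)^2\<close> obeys
  an estimate of the same kind.
\<close>

lemma one_minus_Re_power_bounds:
  fixes z :: complex
  assumes "norm z \<le> 1"
  shows "0 \<le> 1 - Re (z ^ n)" and "1 - Re (z ^ n) \<le> (real n)\<^sup>2 * (1 - Re z)"
proof -
  have polar: "2 * (1 - Re w) = (norm (1 - w))\<^sup>2 + (1 - (norm w)\<^sup>2)" for w
    unfolding cmod_power2 by (simp add: power2_eq_square algebra_simps)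
  show "0 \<le> 1 - Re (z ^ n)"
    using complex_Re_le_cmod[of "z ^ n"] power_le_one[OF norm_ge_zero assms, of n]
    by (simp add: norm_power)
  have "norm (1 - z ^ n) \<le> real n * norm (1 - z)"
    using norm_power_diff[of 1 z n] assms by simp
  then have 1: "(norm (1 - z ^ n))\<^sup>2 \<le> (real n)\<^sup>2 * (norm (1 - z))\<^sup>2"
    unfolding power_mult_distrib[symmetric] by (intro power_mono) auto
  have sq1: "(norm z)\<^sup>2 \<le> 1" using assms by (simp add: power_le_one)
  have "norm (1 - ((norm z)\<^sup>2) ^ n) \<le> real n * norm (1 - (norm z)\<^sup>2)"
    using norm_power_diff[of 1 "(norm z)\<^sup>2" n] sq1 by simp
  also have "real n * norm (1 - (norm z)\<^sup>2) \<le> (real n)\<^sup>2 * (1 - (norm z)\<^sup>2)"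
    using sq1 of_nat_le_iff[of n "n\<^sup>2"] by (intro mult_mono) (auto simp: power2_eq_square)
  finally have 2: "1 - (norm (z ^ n))\<^sup>2 \<le> (real n)\<^sup>2 * (1 - (norm z)\<^sup>2)"
    by (simp add: norm_power mult.commute flip: power_mult)
  show "1 - Re (z ^ n) \<le> (real n)\<^sup>2 * (1 - Re z)"
    using add_mono[OF 1 2] unfolding distrib_left[symmetric] polar[symmetric] by (simp add: algebra_simps)
qed

text \<open>
  A power series is compared with its value at \<open>1\<close> and its linear term.  The second moment \<open>T\<close> of the
  remaining coefficients measures the error, both for real parts and in modulus; the gain of a
  factor \<open>2\<close> in modulus is \<open>n \<le> n^2 / 2\<close> for \<open>n \<ge> 2\<close>.
\<close>

lemma linear_term_dominates:
  fixes c :: "nat \<Rightarrow> real" and z :: complex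
  assumes T: "(\<lambda>n. (real (n + 2))\<^sup>2 * \<bar>c (n + 2)\<bar>) sums T" and z: "norm z \<le> 1"
  shows "(- c 1 - T) * (1 - Re z) \<le> Re (\<Sum>n. of_real (c n) * z ^ n) - (\<Sum>n. c n)"
    and "norm ((\<Sum>n. of_real (c n) * z ^ n) - of_real (\<Sum>n. c n) + of_real (c 1) * (1 - z))
           \<le> T / 2 * norm (1 - z)"
proof -
  define G where "G = (\<Sum>n. of_real (c n) * z ^ n)"
  have sc: "summable (\<lambda>n. \<bar>c n\<bar>)"
  proof -
    have "summable (\<lambda>n. \<bar>c (n + 2)\<bar>)"
    proof (rule summable_comparison_test'[OF sums_summable[OF T]])
      fix n :: nat
      have "1 * \<bar>c (n + 2)\<bar> \<le> (real (n + 2))\<^sup>2 * \<bar>c (n + 2)\<bar>"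
        by (intro mult_right_mono one_le_power) auto
      then show "norm \<bar>c (n + 2)\<bar> \<le> (real (n + 2))\<^sup>2 * \<bar>c (n + 2)\<bar>" by simp
    qed
    then show ?thesis using summable_iff_shift[of "\<lambda>n. \<bar>c n\<bar>" 2] by simp
  qed
  have "summable (\<lambda>n. of_real (c n) * z ^ n)"
  proof (rule summable_comparison_test'[OF sc])
    show "norm (of_real (c n) * z ^ n) \<le> \<bar>c n\<bar>" for n
      using z by (simp add: norm_mult norm_power mult_left_le power_le_one)
  qed
  then have "(\<lambda>n. of_real (c n) * z ^ n - of_real (c n)) sums (G - of_real (\<Sum>n. c n))"
    unfolding G_def using sc
    by (intro sums_diff summable_sums sums_of_real) (auto intro: summable_rabs_cancel)
  from sums_split_initial_segment[OF this, of 2]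
  have sG: "(\<lambda>n. of_real (c (n + 2)) * (z ^ (n + 2) - 1)) sums
      (G - of_real (\<Sum>n. c n) + of_real (c 1) * (1 - z))"
    by (simp add: algebra_simps numeral_2_eq_2)
  have term_Re: "\<bar>Re (of_real (c (n + 2)) * (z ^ (n + 2) - 1))\<bar>
      \<le> (real (n + 2))\<^sup>2 * \<bar>c (n + 2)\<bar> * (1 - Re z)" for n
  proof -
    have "\<bar>Re (of_real (c (n + 2)) * (z ^ (n + 2) - 1))\<bar> = \<bar>c (n + 2)\<bar> * (1 - Re (z ^ (n + 2)))"
      using one_minus_Re_power_bounds(1)[OF z, of "n + 2"] by (simp add: abs_mult del: power_Suc)
    also have "\<dots> \<le> \<bar>c (n + 2)\<bar> * ((real (n + 2))\<^sup>2 * (1 - Re z))"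
      by (intro mult_left_mono one_minus_Re_power_bounds(2) z) auto
    finally show ?thesis by (simp only: mult_ac)
  qed
  have "norm (Re (G - of_real (\<Sum>n. c n) + of_real (c 1) * (1 - z))) \<le> T * (1 - Re z)"
    by (rule norm_sums_le[OF sums_Re[OF sG] sums_mult2[OF T]]) (use term_Re in simp)
  then show "(- c 1 - T) * (1 - Re z) \<le> Re (\<Sum>n. of_real (c n) * z ^ n) - (\<Sum>n. c n)"
    unfolding G_def[symmetric] by (simp add: algebra_simps abs_le_iff)
  have term_norm: "norm (of_real (c (n + 2)) * (z ^ (n + 2) - 1))
      \<le> (real (n + 2))\<^sup>2 * \<bar>c (n + 2)\<bar> * (norm (1 - z) / 2)" for n
  proof -
    have "norm (z ^ (n + 2) - 1) \<le> real (n + 2) * norm (1 - z)"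
      using norm_power_diff[of z 1 "n + 2"] z by (simp add: norm_minus_commute del: power_Suc)
    also have "\<dots> \<le> (real (n + 2))\<^sup>2 / 2 * norm (1 - z)"
      by (intro mult_right_mono) (auto simp: power2_eq_square algebra_simps)
    finally have "\<bar>c (n + 2)\<bar> * norm (z ^ (n + 2) - 1)
        \<le> \<bar>c (n + 2)\<bar> * ((real (n + 2))\<^sup>2 / 2 * norm (1 - z))"
      by (rule mult_left_mono) auto
    then show ?thesis by (simp add: norm_mult mult_ac del: power_Suc)
  qed
  have "norm (G - of_real (\<Sum>n. c n) + of_real (c 1) * (1 - z)) \<le> T * (norm (1 - z) / 2)"
    by (rule norm_sums_le[OF sG sums_mult2[OF T]]) (use term_norm in simp)
  then show "norm ((\<Sum>n. of_real (c n) * z ^ n) - of_real (\<Sum>n. c n) + of_real (c 1) * (1 - z))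
           \<le> T / 2 * norm (1 - z)"
    unfolding G_def[symmetric] by simp
qed

text \<open>
  The constants are sharp for the triangle inequality, as \<open>2 = 2 * (1/3) + 1 + 1 * (1/3)\<close>.
\<close>

lemma Re_mult_cnj_pos:
  assumes "norm (x - 2 * p) < norm p" and "norm (y - p) < norm p / 3"
  shows "0 < Re (x * cnj y)"
proof -
  define d e where "d = x - 2 * p" and "e = y - p"
  have "x * cnj y = p * cnj p + p * cnj p + (2 * p * cnj e + d * cnj p + d * cnj e)"
    by (simp add: d_def e_def algebra_simps)
  also have "p * cnj p + p * cnj p = of_real (2 * (norm p)\<^sup>2)"
    unfolding of_real_mult complex_norm_square by simp
  finally have "Re (x * cnj y) = 2 * (norm p)\<^sup>2 + Re (2 * p * cnj e + d * cnj p + d * cnj e)"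
    by (simp only: plus_complex.sel Re_complex_of_real)
  moreover have "\<bar>Re (2 * p * cnj e + d * cnj p + d * cnj e)\<bar> < 2 * (norm p)\<^sup>2"
  proof -
    have p: "norm p > 0" using assms(1) by (meson norm_ge_zero order_le_less_trans)
    have "\<bar>Re (2 * p * cnj e + d * cnj p + d * cnj e)\<bar>
        \<le> norm (2 * p * cnj e + d * cnj p + d * cnj e)" by (rule abs_Re_le_cmod)
    also have "\<dots> \<le> 2 * norm p * norm e + norm d * norm p + norm d * norm e"
      by (intro order.trans[OF norm_triangle_ineq] add_mono) (auto simp: norm_mult)
    also have "\<dots> < 2 * norm p * (norm p / 3) + norm p * norm p + norm p * (norm p / 3)"
      using assms p by (intro add_strict_mono mult_strict_mono mult_strict_left_mono mult_strict_right_mono)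
        (auto simp: d_def e_def)
    also have "\<dots> = 2 * (norm p)\<^sup>2" by (simp add: power2_eq_square)
    finally show ?thesis .
  qed
  ultimately show ?thesis by linarith
qed

text \<open>
  With \<open>N z = f' z\<close> and \<open>D z = f z / z\<close>, put \<open>X = N z - N 1\<close> and \<open>Y = D z - D 1\<close>.  Both have
  nonnegative real part, and \<open>X \<approx> 2 * p\<close>, \<open>Y \<approx> p\<close> for \<open>p = - a 1 * (1 - z)\<close>.  In the expansion
  \<open>N z * cnj (D z) = N 1 * D 1 + N 1 * cnj Y + D 1 * X + X * cnj Y\<close> all real parts are then
  nonnegative, and that of \<open>X * cnj Y\<close> is positive.  The hypothesis \<open>dom\<close> makes the linear coefficient
  \<open>2 * a 1\<close> of \<open>f'\<close> negative and larger in modulus than the second moment \<open>T\<close> of the later ones.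
\<close>

lemma starlike_if_linear_term_dominates:
  fixes a :: "nat \<Rightarrow> real"
  assumes f: "\<And>z. f z = z * (\<Sum>n. of_real (a n) * z ^ n)"
    and f': "\<And>z. (f has_field_derivative (\<Sum>n. of_real (real (n + 1) * a n) * z ^ n)) (at z)"
    and T: "(\<lambda>n. (real (n + 2))\<^sup>2 * (real (n + 3) * \<bar>a (n + 2)\<bar>)) sums T"
    and dom: "T < - 2 * a 1"
    and nonneg: "0 \<le> (\<Sum>n. real (n + 1) * a n)"
  shows "starlike_fun f"
proof -
  define N where "N = (\<lambda>z::complex. \<Sum>n. of_real (real (n + 1) * a n) * z ^ n)"
  define D where "D = (\<lambda>z::complex. \<Sum>n. of_real (a n) * z ^ n)"
  define N1 where "N1 = (\<Sum>n. real (n + 1) * a n)"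
  define D1 where "D1 = (\<Sum>n. a n)"
  have T_nonneg: "0 \<le> T" by (rule sums_le[OF _ sums_zero T]) simp
  have a1: "a 1 < 0" using dom T_nonneg by simp
  have TN: "(\<lambda>n. (real (n + 2))\<^sup>2 * \<bar>real (n + 2 + 1) * a (n + 2)\<bar>) sums T"
    using T by (simp add: abs_mult add_ac)
  obtain U where U: "(\<lambda>n. (real (n + 2))\<^sup>2 * \<bar>a (n + 2)\<bar>) sums U" and U_le: "U \<le> T / 3"
  proof -
    have le: "(real (n + 2))\<^sup>2 * \<bar>a (n + 2)\<bar> \<le> (real (n + 2))\<^sup>2 * (real (n + 3) * \<bar>a (n + 2)\<bar>) / 3" for n
    proof -
      have "3 * ((real (n + 2))\<^sup>2 * \<bar>a (n + 2)\<bar>) \<le> real (n + 3) * ((real (n + 2))\<^sup>2 * \<bar>a (n + 2)\<bar>)"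
        by (intro mult_right_mono) auto
      then show ?thesis by (simp add: mult_ac)
    qed
    have s: "summable (\<lambda>n. (real (n + 2))\<^sup>2 * \<bar>a (n + 2)\<bar>)"
      by (rule summable_comparison_test'[OF sums_summable[OF sums_divide[OF T, of 3]]])
         (use le in simp)
    from that[OF summable_sums[OF s]] sums_le[OF le summable_sums[OF s] sums_divide[OF T]]
    show ?thesis by blast
  qed
  have N_Re: "N1 + (- 2 * a 1 - T) * (1 - Re z) \<le> Re (N z)"
    and N_norm: "norm (N z - of_real N1 - 2 * (of_real (- a 1) * (1 - z))) \<le> T / 2 * norm (1 - z)"
    if "norm z \<le> 1" for z
    using linear_term_dominates[OF TN that] by (simp_all add: N_def N1_def algebra_simps)
  have D_Re: "D1 + (- a 1 - U) * (1 - Re z) \<le> Re (D z)"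
    and D_norm: "norm (D z - of_real D1 - of_real (- a 1) * (1 - z)) \<le> U / 2 * norm (1 - z)"
    if "norm z \<le> 1" for z
    using linear_term_dominates[OF U that] by (simp_all add: D_def D1_def algebra_simps)
  have Re_less: "0 < 1 - Re z" if "z \<in> \<D>" for z :: complex
    using that complex_Re_le_cmod[of z] by simp
  have N_ge: "N1 \<le> Re (N z)" and D_ge: "D1 \<le> Re (D z)" if z: "norm z \<le> 1" for z
  proof -
    have "0 \<le> 1 - Re z" using complex_Re_le_cmod[of z] z by simp
    then have "0 \<le> (- 2 * a 1 - T) * (1 - Re z)" "0 \<le> (- a 1 - U) * (1 - Re z)"
      using dom U_le T_nonneg by (auto intro!: mult_nonneg_nonneg simp del: One_nat_def)
    then show "N1 \<le> Re (N z)" "D1 \<le> Re (D z)"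
      using N_Re[OF z] D_Re[OF z] by linarith+
  qed
  have N1_nonneg: "N1 \<ge> 0" using nonneg by (simp add: N1_def)
  have D1_nonneg: "D1 \<ge> 0"
  proof -
    \<comment> \<open>\<open>f\<close> is real and increasing on \<open>[0, 1]\<close> from \<open>0\<close> to \<open>D1\<close>.\<close>
    have "D 1 = of_real D1" using D_norm[of 1] by simp
    moreover obtain u where u: "u \<in> closed_segment 0 1" "Re (f 1) - Re (f 0) = Re (N u * (1 - 0))"
      using complex_mvt_line[of 0 1 f N] f' unfolding N_def by blast
    moreover have "norm u \<le> 1" using u(1) by (auto simp: closed_segment_def)
    then have "0 \<le> Re (N u)"
      using N_ge[of u] N1_nonneg by linarith
    ultimately show ?thesis by (simp add: f D_def)
  qed
  have Re_N_pos: "0 < Re (N z)" if "z \<in> \<D>" for z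
    using N_Re[of z] N1_nonneg mult_pos_pos[OF _ Re_less[OF that], of "- 2 * a 1 - T"] dom that
    by auto
  show ?thesis
  proof (rule starlike_criterion)
    show "f holomorphic_on \<D>"
      using f' by (meson holomorphic_onI has_field_derivative_at_within field_differentiable_def)
    show "f 0 = 0" by (simp add: f)
    show "inj_on f \<D>"
      by (rule noshiro_warschawski[where f' = N and c = 1])
         (use f' Re_N_pos in \<open>auto simp: N_def\<close>)
    fix z assume z: "z \<in> \<D>" "z \<noteq> 0"
    define X Y where "X = N z - of_real N1" and "Y = D z - of_real D1"
    have nz: "0 < norm (1 - z)" using Re_less[OF z(1)] by auto
    have X_Re: "0 \<le> Re X" and Y_Re: "0 \<le> Re Y"
      using N_ge[of z] D_ge[of z] z by (simp_all add: X_def Y_def)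
    have "0 < Re (X * cnj Y)"
    proof (rule Re_mult_cnj_pos[where p = "of_real (- a 1) * (1 - z)"])
      have np: "norm (of_real (- a 1) * (1 - z)) = - a 1 * norm (1 - z)"
        using a1 by (simp only: norm_mult norm_of_real)
      have "T / 2 * norm (1 - z) < - a 1 * norm (1 - z)"
        "U / 2 * norm (1 - z) < - a 1 / 3 * norm (1 - z)"
        using dom U_le nz by (intro mult_strict_right_mono; simp)+
      then show "norm (X - 2 * (of_real (- a 1) * (1 - z))) < norm (of_real (- a 1) * (1 - z))"
        "norm (Y - of_real (- a 1) * (1 - z)) < norm (of_real (- a 1) * (1 - z)) / 3"
        unfolding np X_def Y_def using N_norm[of z] D_norm[of z] z by auto
    qed
    have "N z * cnj (D z) = of_real (N1 * D1) + of_real N1 * cnj Y + of_real D1 * X + X * cnj Y"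
      by (simp add: X_def Y_def algebra_simps)
    moreover have "Re (of_real r * w) = r * Re w" for r w by simp
    ultimately have "Re (N z * cnj (D z)) = N1 * D1 + N1 * Re Y + D1 * Re X + Re (X * cnj Y)"
      by (simp only: plus_complex.sel Re_complex_of_real complex_cnj cnj.sel)
    then have "0 < Re (N z * cnj (D z))"
      using N1_nonneg D1_nonneg X_Re Y_Re \<open>0 < Re (X * cnj Y)\<close>
      by (metis add_nonneg_nonneg add_nonneg_pos mult_nonneg_nonneg)
    moreover have "deriv f z = N z" using f' by (simp add: DERIV_imp_deriv N_def)
    moreover have "f z / z = D z" using z by (simp add: f D_def)
    ultimately show "0 < Re (deriv f z * cnj (f z / z))" by simp
  qed
qed

section \<open>Geometrically decaying power series\<close>

lemma
  fixes c :: "nat \<Rightarrow> 'a::{real_normed_field,banach}"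
  assumes "\<And>z. summable (\<lambda>n. c n * z ^ n)"
  shows summable_diffs_funpow: "\<And>z. summable (\<lambda>n. (diffs ^^ k) c n * z ^ n)"
    and deriv_funpow_power_series:
      "(deriv ^^ k) (\<lambda>z. \<Sum>n. c n * z ^ n) = (\<lambda>z. \<Sum>n. (diffs ^^ k) c n * z ^ n)"
proof (induction k)
  case 0
  { case 1 show ?case using assms by simp }
  { case 2 show ?case by simp }
next
  case (Suc k)
  { case 1 show ?case using termdiff_converges_all[OF Suc(1)] by simp }
  { case 2 show ?case
      using termdiffs_strong_converges_everywhere[OF Suc(1)] Suc(2)
      by (auto intro!: ext DERIV_imp_deriv) }
qed

lemma diffs_funpow: "(diffs ^^ k) c n = pochhammer (of_nat (Suc n)) k * c (n + k)"
  for c :: "nat \<Rightarrow> 'a::comm_ring_1"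
  by (induction k arbitrary: n) (simp_all add: diffs_def pochhammer_rec pochhammer_Suc add_ac mult_ac)

lemma geometric_series_bound:
  fixes x :: "nat \<Rightarrow> 'a::banach"
  assumes ratio: "\<And>n. norm (x (Suc n)) \<le> q * norm (x n)" and q: "0 \<le> q" "q < 1"
  shows "summable (\<lambda>n. norm (x n))" and "(\<Sum>n. norm (x n)) \<le> norm (x 0) / (1 - q)"
    and "norm (\<Sum>n. x n) \<le> norm (x 0) / (1 - q)"
proof -
  have le: "norm (x n) \<le> norm (x 0) * q ^ n" for n
  proof (induction n)
    case (Suc n)
    have "norm (x (Suc n)) \<le> q * (norm (x 0) * q ^ n)"
      using ratio[of n] mult_left_mono[OF Suc q(1)] by linarith
    then show ?case by (simp add: mult_ac)
  qed simp
  have g: "(\<lambda>n. norm (x 0) * q ^ n) sums (norm (x 0) / (1 - q))"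
    using sums_mult[OF geometric_sums[of q], of "norm (x 0)"] q by simp
  show s: "summable (\<lambda>n. norm (x n))"
    by (rule summable_comparison_test'[OF sums_summable[OF g]]) (use le in simp)
  show "(\<Sum>n. norm (x n)) \<le> norm (x 0) / (1 - q)"
    by (rule sums_le[OF le summable_sums[OF s] g])
  show "norm (\<Sum>n. x n) \<le> norm (x 0) / (1 - q)"
    by (rule norm_sums_le[OF summable_sums[OF summable_norm_cancel[OF s]] g le])
qed

text \<open>
  The terms after the constant one add up to at most \<open>q / (1 - q) < 1\<close> times the constant term.
\<close>

lemma Re_power_series_quotient_pos:
  fixes d :: "nat \<Rightarrow> complex"
  assumes d0: "d 0 \<noteq> 0" and ratio: "\<And>n. norm (d (Suc n)) \<le> q * norm (d n)" and q: "0 \<le> q" "q < 1 / 2"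
    and z: "norm z \<le> 1"
  shows "0 < Re ((\<Sum>n. d n * z ^ n) / d 0)"
proof -
  define x where "x = (\<lambda>n. d n * z ^ n / d 0)"
  have xr: "norm (x (Suc n)) \<le> q * norm (x n)" for n
  proof -
    have "norm (d (Suc n)) * norm (z ^ Suc n) \<le> q * norm (d n) * norm (z ^ n)"
      using ratio[of n] z q by (intro mult_mono) (auto simp: norm_mult mult_left_le_one_le)
    then show ?thesis by (simp add: x_def norm_mult norm_divide divide_right_mono)
  qed
  have q1: "q < 1" using q by simp
  have sx: "summable x"
    using geometric_series_bound(1)[of x, OF xr q(1) q1] by (rule summable_norm_cancel)
  have "norm (\<Sum>n. x (Suc n)) \<le> norm (x (Suc 0)) / (1 - q)"
    using geometric_series_bound(3)[of "\<lambda>n. x (Suc n)", OF xr q(1) q1] by simp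
  also have "\<dots> \<le> q * norm (x 0) / (1 - q)"
    using q1 by (intro divide_right_mono xr) simp
  also have "\<dots> < 1" using d0 q by (simp add: x_def field_simps)
  finally have "norm (suminf x - 1) < 1"
    using suminf_split_head[OF sx] d0 by (simp add: x_def)
  then have "0 < Re (suminf x)"
    using abs_Re_le_cmod[of "suminf x - 1"] by simp
  moreover have "summable (\<lambda>n. d n * z ^ n)"
    using summable_mult[OF sx, of "d 0"] d0 by (simp add: x_def)
  then have "suminf x = (\<Sum>n. d n * z ^ n) / d 0"
    by (simp add: x_def suminf_divide)
  ultimately show ?thesis by simp
qed

lemma close_to_convex_linear:
  assumes der: "\<And>z. z \<in> \<D> \<Longrightarrow> (h has_field_derivative h' z) (at z)"
    and c: "c \<noteq> 0" and pos: "\<And>z. z \<in> \<D> \<Longrightarrow> 0 < Re (h' z / c)"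
  shows "close_to_convex h"
proof -
  have deriv_lin: "deriv ((*) c) z = c" for z
    by (rule DERIV_imp_deriv) (auto intro!: derivative_eq_intros)
  have "0 < Re (deriv h z / deriv ((*) c) z)" if "z \<in> \<D>" for z
    using pos[OF that] DERIV_imp_deriv[OF der[OF that]] by (simp add: deriv_lin)
  moreover have "convex ((*) c ` \<D>)"
    by (intro convex_linear_image bounded_linear.linear[OF bounded_linear_mult_right] convex_ball)
  moreover have "inj_on ((*) c) \<D>" using c by (auto simp: inj_on_def)
  moreover have "h holomorphic_on \<D>"
    using der by (meson holomorphic_onI has_field_derivative_at_within field_differentiable_def)
  moreover have "(*) c holomorphic_on \<D>" by (intro holomorphic_intros)
  ultimately show ?thesis
    unfolding close_to_convex_def by blast
qed

section \<open>Decay of the Taylor coefficients\<close>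

text \<open>
  The modulus of the Taylor coefficient of \<open>bessel_deriv_fun \<nu>\<close> at \<open>z ^ Suc n\<close>; the sign of the
  coefficient is \<open>(-1) ^ n\<close>.
\<close>

definition bessel_mag :: "real \<Rightarrow> nat \<Rightarrow> real" where
  "bessel_mag \<nu> n = (2 * real n + \<nu>) * Gamma \<nu> / (4 ^ n * fact n * Gamma (real n + \<nu> + 1))"

definition mag_ratio :: "real \<Rightarrow> nat \<Rightarrow> real" where
  "mag_ratio \<nu> n = (2 * real n + 2 + \<nu>) / (4 * (real n + 1) * (2 * real n + \<nu>) * (real n + 1 + \<nu>))"

text \<open>
  The derivative of \<open>bessel_deriv_fun \<nu>\<close> at \<open>1\<close>, as a real number.
\<close>

definition slope_at_1 :: "real \<Rightarrow> real" where
  "slope_at_1 \<nu> = (\<Sum>n. real (n + 1) * ((-1) ^ n * bessel_mag \<nu> n))"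

lemma bessel_mag_pos: "\<nu> > 0 \<Longrightarrow> bessel_mag \<nu> n > 0"
  unfolding bessel_mag_def by (intro divide_pos_pos mult_pos_pos Gamma_real_pos) auto

lemma bessel_mag_0:
  assumes "\<nu> > 0"
  shows "bessel_mag \<nu> 0 = 1"
proof -
  have "\<nu> \<notin> \<int>\<^sub>\<le>\<^sub>0" using assms nonpos_Ints_nonpos[of \<nu>] by auto
  moreover have "Gamma \<nu> \<noteq> 0" using Gamma_real_pos[OF assms] by linarith
  ultimately show ?thesis using assms by (simp add: bessel_mag_def Gamma_plus1)
qed

lemma mag_ratio_pos: "\<nu> > 0 \<Longrightarrow> mag_ratio \<nu> n > 0"
  unfolding mag_ratio_def by (intro divide_pos_pos mult_pos_pos) auto

lemma bessel_mag_Suc: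
  assumes "\<nu> > 0"
  shows "bessel_mag \<nu> (Suc n) = mag_ratio \<nu> n * bessel_mag \<nu> n"
proof -
  have "real n + \<nu> + 1 > 0" using assms by simp
  then have "real n + \<nu> + 1 \<notin> \<int>\<^sub>\<le>\<^sub>0" using nonpos_Ints_nonpos by fastforce
  from Gamma_plus1[OF this]
  have G: "Gamma (real (Suc n) + \<nu> + 1) = (real n + 1 + \<nu>) * Gamma (real n + \<nu> + 1)"
    by (simp add: add_ac)
  define g where "g = Gamma (real n + \<nu> + 1)"
  have "g > 0" unfolding g_def using assms by (intro Gamma_real_pos) simp
  then have nz: "g \<noteq> 0" "2 * real n + \<nu> \<noteq> 0" "real n + 1 + \<nu> \<noteq> 0"
    using assms by auto
  show ?thesis
    unfolding bessel_mag_def mag_ratio_def G g_def[symmetric] fact_Suc power_Suc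
    using nz by (simp add: divide_simps) (simp add: algebra_simps)
qed

lemma bessel_mag_1: "\<nu> > 0 \<Longrightarrow> bessel_mag \<nu> 1 = (2 + \<nu>) / (4 * \<nu> * (\<nu> + 1))"
  using bessel_mag_Suc[of \<nu> 0] by (simp add: bessel_mag_0 mag_ratio_def add_ac)

lemma mag_ratio_le:
  assumes "\<nu> > 0" "n \<ge> 1"
  shows "mag_ratio \<nu> n \<le> 1 / (4 * real n * (real n + 1))"
proof -
  have "(2 * real n + 2 + \<nu>) * real n \<le> (2 * real n + \<nu>) * (real n + 1 + \<nu>)"
    using assms by (simp add: algebra_simps)
  moreover have "0 < (2 * real n + \<nu>) * (real n + 1 + \<nu>)" using assms by (intro mult_pos_pos) auto
  ultimately have "(2 * real n + 2 + \<nu>) / ((2 * real n + \<nu>) * (real n + 1 + \<nu>)) \<le> 1 / real n"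
    using assms by (simp add: divide_simps)
  then have "(2 * real n + 2 + \<nu>) / ((2 * real n + \<nu>) * (real n + 1 + \<nu>)) / (4 * (real n + 1))
      \<le> 1 / real n / (4 * (real n + 1))"
    by (rule divide_right_mono) simp
  then show ?thesis by (simp add: mag_ratio_def mult_ac)
qed

text \<open>
  Every geometric decay of coefficients multiplied by polynomial weights is reduced to an
  inequality between consecutive weights, uniformly in \<open>\<nu>\<close>.
\<close>

lemma weighted_mag_decay:
  assumes \<nu>: "\<nu> > 0" and n: "n \<ge> 1" and w': "0 \<le> w'"
    and le: "w' \<le> q * w * (4 * real n * (real n + 1))"
  shows "w' * bessel_mag \<nu> (Suc n) \<le> q * (w * bessel_mag \<nu> n)"
proof -
  have "w' * mag_ratio \<nu> n \<le> w' * (1 / (4 * real n * (real n + 1)))"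
    by (intro mult_left_mono mag_ratio_le \<nu> n w')
  also have "\<dots> \<le> q * w"
    using le n by (simp add: pos_divide_le_eq)
  finally have "w' * mag_ratio \<nu> n * bessel_mag \<nu> n \<le> q * w * bessel_mag \<nu> n"
    using bessel_mag_pos[OF \<nu>, of n] by (intro mult_right_mono) auto
  then show ?thesis by (simp add: bessel_mag_Suc[OF \<nu>] mult_ac)
qed

text \<open>
  With \<open>A = bessel_mag \<nu>\<close>, the sum \<open>T\<close> starts with \<open>12 * A 2 \<le> (3/2) * A 1\<close> and decays at least by the factor \<open>1/8\<close>, so that
  it is at most \<open>(3/2) * (8/7) * A 1 = (12/7) * A 1\<close>.
\<close>

lemma bessel_mag_second_moment:
  assumes \<nu>: "\<nu> > 0"
  obtains T where "(\<lambda>n. (real (n + 2))\<^sup>2 * (real (n + 3) * bessel_mag \<nu> (n + 2))) sums T"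
    and "T < 2 * bessel_mag \<nu> 1"
proof -
  define x where "x = (\<lambda>n. (real (n + 2))\<^sup>2 * real (n + 3) * bessel_mag \<nu> (n + 2))"
  have x_pos: "0 < x n" for n
    using bessel_mag_pos[OF \<nu>, of "n + 2"] by (simp add: x_def)
  have "x (Suc n) \<le> 1 / 8 * x n" for n
  proof -
    have "8 * (real n + 4) \<le> 4 * (real n + 2) ^ 3"
      by (simp add: power3_eq_cube algebra_simps)
    then have "8 * (real n + 4) * (real n + 3)\<^sup>2 \<le> 4 * (real n + 2) ^ 3 * (real n + 3)\<^sup>2"
      by (rule mult_right_mono) simp
    moreover have "8 * (real n + 4) * (real n + 3)\<^sup>2 = 8 * ((real (n + 3))\<^sup>2 * real (n + 4))"
      by simp
    moreover have "4 * (real n + 2) ^ 3 * (real n + 3)\<^sup>2 =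
        8 * (1 / 8 * ((real (n + 2))\<^sup>2 * real (n + 3)) * (4 * real (n + 2) * (real (n + 2) + 1)))"
      by (simp add: power2_eq_square power3_eq_cube add_ac mult_ac)
    ultimately have "(real (n + 3))\<^sup>2 * real (n + 4)
        \<le> 1 / 8 * ((real (n + 2))\<^sup>2 * real (n + 3)) * (4 * real (n + 2) * (real (n + 2) + 1))"
      by linarith
    from weighted_mag_decay[OF \<nu> _ _ this] show ?thesis
      by (simp add: x_def numeral_eq_Suc)
  qed
  then have ratio: "norm (x (Suc n)) \<le> 1 / 8 * norm (x n)" for n
    using x_pos by (simp add: less_imp_le)
  have nx: "norm (x n) = x n" for n using x_pos[of n] by simp
  note bound = geometric_series_bound[of x, OF ratio, unfolded nx, simplified]
  have "12 * bessel_mag \<nu> (Suc 1) \<le> 3 / 2 * (1 * bessel_mag \<nu> 1)"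
    by (rule weighted_mag_decay[OF \<nu>]) auto
  then have "suminf x < 2 * bessel_mag \<nu> 1"
    using bound(2) bessel_mag_pos[OF \<nu>, of 1] by (simp add: x_def numeral_eq_Suc)
  with summable_sums[OF bound(1)] show ?thesis
    by (intro that[of "suminf x"]) (simp_all add: x_def mult.assoc)
qed

section \<open>The derivative at 1 as a function of the order\<close>

text \<open>
  From index \<open>4\<close> on, the terms decay at least by the factor \<open>1/8\<close>, so that they add up to at most
  \<open>(8/7) * 5 * A 4\<close>, where \<open>A\<close> is \<open>bessel_mag \<nu>\<close>.  Four terms suffice to see the sign on both sides
  of the zero.
\<close>

lemma
  assumes \<nu>: "\<nu> > 0"
  shows slope_terms_summable: "summable (\<lambda>n. real (n + 1) * ((-1) ^ n * bessel_mag \<nu> n))"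
    and slope_at_1_approx: "\<bar>slope_at_1 \<nu> - (\<Sum>n<4. real (n + 1) * ((-1) ^ n * bessel_mag \<nu> n))\<bar> \<le> 6 * bessel_mag \<nu> 4"
proof -
  define x where "x = (\<lambda>n. real (n + 1) * ((-1) ^ n * bessel_mag \<nu> n))"
  have "norm (x (Suc n + 4)) \<le> 1 / 8 * norm (x (n + 4))" for n
  proof -
    have "real (n + 6) \<le> real (n + 5) * 2" by simp
    also have "\<dots> \<le> real (n + 5) * (1 / 2 * real (n + 4) * (real (n + 4) + 1))"
    proof (rule mult_left_mono)
      have "2 \<le> 1 / 2 * 4 * (1::real)" by simp
      also have "\<dots> \<le> 1 / 2 * real (n + 4) * (real (n + 4) + 1)" by (intro mult_mono) auto
      finally show "2 \<le> 1 / 2 * real (n + 4) * (real (n + 4) + 1)" .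
    qed simp
    also have "\<dots> = 1 / 8 * real (n + 5) * (4 * real (n + 4) * (real (n + 4) + 1))" by simp
    finally have "real (n + 6) \<le> 1 / 8 * real (n + 5) * (4 * real (n + 4) * (real (n + 4) + 1))" .
    from weighted_mag_decay[OF \<nu> _ _ this] show ?thesis
      using bessel_mag_pos[OF \<nu>, of "n + 4"] bessel_mag_pos[OF \<nu>, of "n + 5"]
      by (simp add: x_def abs_mult power_abs numeral_eq_Suc)
  qed
  note bound = geometric_series_bound[of "\<lambda>n. x (n + 4)", OF this, simplified]
  from summable_norm_cancel[of "\<lambda>n. x (n + 4)"] bound(1) have sx: "summable x"
    by (simp add: summable_iff_shift)
  then show "summable (\<lambda>n. real (n + 1) * ((-1) ^ n * bessel_mag \<nu> n))" by (simp add: x_def)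
  have "slope_at_1 \<nu> = suminf x" by (simp add: slope_at_1_def x_def)
  also have "\<dots> = (\<Sum>n. x (n + 4)) + sum x {..<4}"
    by (rule suminf_split_initial_segment[OF sx])
  finally have "slope_at_1 \<nu> - sum x {..<4} = (\<Sum>n. x (n + 4))" by simp
  moreover have "\<bar>\<Sum>n. x (n + 4)\<bar> \<le> \<bar>x 4\<bar> / (7 / 8)"
    using bound(3) by simp
  moreover have "\<bar>x 4\<bar> / (7 / 8) \<le> 6 * bessel_mag \<nu> 4"
    using bessel_mag_pos[OF \<nu>, of 4] by (simp add: x_def abs_mult)
  ultimately show "\<bar>slope_at_1 \<nu> - (\<Sum>n<4. real (n + 1) * ((-1) ^ n * bessel_mag \<nu> n))\<bar> \<le> 6 * bessel_mag \<nu> 4"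
    by (simp add: x_def)
qed

text \<open>
  Together with \<open>mag_ratio_antimono\<close>, this bounds the relative decrease of \<open>mag_ratio\<close> in \<open>\<nu>\<close> by that
  of \<open>1 / \<nu>^2\<close>.
\<close>

lemma square_mag_ratio_mono:
  assumes "0 < \<mu>" "\<mu> \<le> \<nu>"
  shows "\<mu>\<^sup>2 * mag_ratio \<mu> n \<le> \<nu>\<^sup>2 * mag_ratio \<nu> n"
proof -
  have frac: "\<mu> / (a + \<mu>) \<le> \<nu> / (a + \<nu>)" if "a \<ge> 0" for a
    using that assms mult_left_mono[OF assms(2) that] by (simp add: divide_simps algebra_simps)
  have eq: "x\<^sup>2 * mag_ratio x n = (2 * real n + 2 + x) * (x / (2 * real n + x)) * (x / (real n + 1 + x)) / (4 * (real n + 1))" for x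
    by (simp add: mag_ratio_def power2_eq_square mult_ac)
  show ?thesis
    unfolding eq using assms by (intro divide_right_mono mult_mono frac) auto
qed

lemma mag_ratio_antimono:
  assumes "0 < \<mu>" "\<mu> \<le> \<nu>"
  shows "mag_ratio \<nu> n \<le> mag_ratio \<mu> n"
proof -
  have eq: "mag_ratio x n = (1 + 2 / (2 * real n + x)) * (1 / (real n + 1 + x)) / (4 * (real n + 1))" if "x > 0" for x
    using that by (simp add: mag_ratio_def divide_simps)
  have "0 < \<nu>" using assms by simp
  show ?thesis
    unfolding eq[OF assms(1)] eq[OF \<open>0 < \<nu>\<close>] using assms
    by (intro divide_right_mono mult_mono add_left_mono divide_left_mono) auto
qed

lemma bessel_mag_antimono:
  assumes "0 < \<mu>" "\<mu> \<le> \<nu>"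
  shows "bessel_mag \<nu> n \<le> bessel_mag \<mu> n"
proof (induction n)
  case 0
  then show ?case using assms by (simp add: bessel_mag_0)
next
  case (Suc n)
  then show ?case
    using assms mag_ratio_antimono[OF assms, of n] bessel_mag_pos[of \<nu> n] mag_ratio_pos[of \<mu> n]
    by (simp add: bessel_mag_Suc mult_mono less_imp_le)
qed

text \<open>
  A positive lower bound for the decrease of the coefficients in \<open>\<nu>\<close>: they decrease at least as
  fast as \<open>1 / \<nu>\<close>.  For the coefficient with index \<open>0\<close>, which is constant, this is false.
\<close>

lemma scaled_bessel_mag_antimono:
  assumes "0 < \<mu>" "\<mu> \<le> \<nu>"
  shows "\<nu> * bessel_mag \<nu> (Suc n) \<le> \<mu> * bessel_mag \<mu> (Suc n)"
proof (induction n)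
  case 0
  have eq: "x * bessel_mag x 1 = (1 + 1 / (x + 1)) / 4" if "x > 0" for x
    using that by (simp add: bessel_mag_1[simplified] divide_simps)
  have "1 / (\<nu> + 1) \<le> 1 / (\<mu> + 1)" using assms by (intro divide_left_mono) auto
  then have "\<nu> * bessel_mag \<nu> 1 \<le> \<mu> * bessel_mag \<mu> 1"
    using assms by (subst (1 2) eq) auto
  then show ?case by simp
next
  case (Suc n)
  have "mag_ratio \<nu> (Suc n) * (\<nu> * bessel_mag \<nu> (Suc n)) \<le> mag_ratio \<mu> (Suc n) * (\<mu> * bessel_mag \<mu> (Suc n))"
    using assms bessel_mag_pos[of \<nu> "Suc n"] mag_ratio_pos[of \<mu> "Suc n"]
    by (intro mult_mono[OF mag_ratio_antimono Suc]) auto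
  then show ?case using assms by (simp add: bessel_mag_Suc mult_ac)
qed

text \<open>
  The increments in \<open>\<nu>\<close> decay almost like the coefficients themselves.  The product rule gives a term
  with the increment of \<open>mag_ratio\<close>; that increment is, relatively, at most twice \<open>(\<nu> - \<mu>) / \<mu>\<close>, which
  is in turn a lower bound for the relative increment of \<open>bessel_mag\<close>.  Hence the factor
  \<open>3 = 1 + 2\<close>.
\<close>

lemma bessel_mag_diff_decay:
  assumes \<mu>: "0 < \<mu>" "\<mu> \<le> \<nu>" and n: "n \<ge> 1"
  shows "bessel_mag \<mu> (Suc n) - bessel_mag \<nu> (Suc n)
    \<le> 3 / (4 * real n * (real n + 1)) * (bessel_mag \<mu> n - bessel_mag \<nu> n)"
proof -
  define \<Delta> where "\<Delta> = bessel_mag \<mu> n - bessel_mag \<nu> n"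
  define r s m where "r = mag_ratio \<mu> n" and "s = mag_ratio \<nu> n" and "m = bessel_mag \<nu> n"
  have pos: "\<nu> > 0" "r > 0" "m > 0"
    using \<mu> by (simp_all add: r_def m_def mag_ratio_pos bessel_mag_pos)
  have \<Delta>: "m * (\<nu> - \<mu>) \<le> \<mu> * \<Delta>"
    using scaled_bessel_mag_antimono[OF \<mu>, of "n - 1"] n by (simp add: \<Delta>_def m_def algebra_simps)
  have \<Delta>_nonneg: "\<Delta> \<ge> 0" using bessel_mag_antimono[OF \<mu>] by (simp add: \<Delta>_def)
  have "\<nu>\<^sup>2 * (r - s) \<le> (\<nu>\<^sup>2 - \<mu>\<^sup>2) * r"
    using square_mag_ratio_mono[OF \<mu>, of n] by (simp add: r_def s_def algebra_simps)
  also have "\<dots> = (\<nu> - \<mu>) * (\<nu> + \<mu>) * r" by (simp add: power2_eq_square algebra_simps)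
  also have "\<dots> \<le> (\<nu> - \<mu>) * (2 * \<nu>) * r"
    using \<mu> pos by (intro mult_right_mono mult_left_mono) auto
  finally have "\<nu> * (\<nu> * (r - s)) \<le> \<nu> * (2 * (\<nu> - \<mu>) * r)"
    by (simp add: power2_eq_square mult_ac)
  then have "\<nu> * (r - s) \<le> 2 * (\<nu> - \<mu>) * r" using pos by simp
  then have "m * (\<nu> * (r - s)) \<le> m * (2 * (\<nu> - \<mu>) * r)" using pos by (intro mult_left_mono) auto
  also have "\<dots> = m * (\<nu> - \<mu>) * (2 * r)" by simp
  also have "\<dots> \<le> \<mu> * \<Delta> * (2 * r)" using pos by (intro mult_right_mono \<Delta>) auto
  also have "\<dots> \<le> \<nu> * \<Delta> * (2 * r)" using pos \<mu> \<Delta>_nonneg by (intro mult_right_mono) auto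
  finally have "\<nu> * (m * (r - s)) \<le> \<nu> * (2 * r * \<Delta>)" by (simp add: mult_ac)
  then have "m * (r - s) \<le> 2 * r * \<Delta>" using pos by simp
  moreover have "bessel_mag \<mu> (Suc n) - bessel_mag \<nu> (Suc n) = r * \<Delta> + m * (r - s)"
    using \<mu> pos by (simp add: bessel_mag_Suc \<Delta>_def r_def s_def m_def algebra_simps)
  ultimately have "bessel_mag \<mu> (Suc n) - bessel_mag \<nu> (Suc n) \<le> 3 * r * \<Delta>" by linarith
  also have "\<dots> \<le> 3 * (1 / (4 * real n * (real n + 1))) * \<Delta>"
    unfolding r_def using \<Delta>_nonneg by (intro mult_right_mono mult_left_mono mag_ratio_le \<mu> n) auto
  finally show ?thesis by (simp add: \<Delta>_def)
qed

text \<open>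
  With \<open>\<Delta> n\<close> the increments of \<open>bessel_mag\<close>, the contribution \<open>2 * \<Delta> 1\<close> of the linear coefficient is
  counteracted by later ones of total size at most \<open>3 * (3/8) * (6/5) * \<Delta> 1 = (27/20) * \<Delta> 1\<close>.
\<close>

lemma slope_at_1_increment:
  assumes \<mu>: "0 < \<mu>" "\<mu> \<le> \<nu>"
  shows "13 / 20 * (bessel_mag \<mu> 1 - bessel_mag \<nu> 1) \<le> slope_at_1 \<nu> - slope_at_1 \<mu>"
    and "slope_at_1 \<nu> - slope_at_1 \<mu> \<le> 67 / 20 * (bessel_mag \<mu> 1 - bessel_mag \<nu> 1)"
proof -
  define \<Delta> where "\<Delta> = (\<lambda>n. bessel_mag \<mu> n - bessel_mag \<nu> n)"
  define y where "y = (\<lambda>n. real (n + 1) * ((-1) ^ n * bessel_mag \<nu> n) - real (n + 1) * ((-1) ^ n * bessel_mag \<mu> n))"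
  have \<nu>: "\<nu> > 0" using \<mu> by simp
  have \<Delta>_nonneg: "\<Delta> n \<ge> 0" for n using bessel_mag_antimono[OF \<mu>] by (simp add: \<Delta>_def)
  have \<Delta>_Suc: "\<Delta> (Suc n) \<le> 3 / (4 * real n * (real n + 1)) * \<Delta> n" if "n \<ge> 1" for n
    using bessel_mag_diff_decay[OF \<mu> that] by (simp add: \<Delta>_def)
  have y_eq: "y n = - (real (n + 1) * ((-1) ^ n * \<Delta> n))" for n by (simp add: y_def \<Delta>_def algebra_simps)
  have y_norm: "norm (y n) = real (n + 1) * \<Delta> n" for n
    using \<Delta>_nonneg[of n] by (simp add: y_eq abs_mult power_abs)
  have sy: "y sums (slope_at_1 \<nu> - slope_at_1 \<mu>)"
    unfolding y_def slope_at_1_def by (intro sums_diff summable_sums slope_terms_summable \<nu> \<mu>)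
  have "norm (y (Suc n + 2)) \<le> 1 / 6 * norm (y (n + 2))" for n
  proof -
    have "6 * (real n + 4) * 3 \<le> 4 * (real n + 2) * (real n + 3) * (real n + 3)"
      by (simp add: algebra_simps)
    then have c: "(real n + 4) * (3 / (4 * (real n + 2) * (real n + 3))) \<le> 1 / 6 * (real n + 3)"
      by (simp add: divide_simps mult_ac)
    have "(real n + 4) * \<Delta> (Suc (n + 2)) \<le> (real n + 4) * (3 / (4 * real (n + 2) * (real (n + 2) + 1)) * \<Delta> (n + 2))"
      by (intro mult_left_mono \<Delta>_Suc) auto
    also have "\<dots> = (real n + 4) * (3 / (4 * (real n + 2) * (real n + 3))) * \<Delta> (n + 2)"
      by (simp add: add_ac)
    also have "\<dots> \<le> 1 / 6 * (real n + 3) * \<Delta> (n + 2)"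
      by (intro mult_right_mono c \<Delta>_nonneg)
    finally show ?thesis unfolding y_norm by (simp add: add_ac)
  qed
  from geometric_series_bound(3)[of "\<lambda>n. y (n + 2)", OF this]
  have "norm (\<Sum>n. y (n + 2)) \<le> norm (y 2) / (1 - 1 / 6)"
    by (simp only: add_0)
  also have "\<dots> = 18 / 5 * \<Delta> 2" unfolding y_norm by simp
  also have "\<dots> \<le> 18 / 5 * (3 / 8 * \<Delta> 1)" using \<Delta>_Suc[of 1] by (simp add: numeral_2_eq_2)
  finally have "\<bar>\<Sum>n. y (n + 2)\<bar> \<le> 27 / 20 * \<Delta> 1" by simp
  moreover have "(\<Sum>n. y (n + 2)) = slope_at_1 \<nu> - slope_at_1 \<mu> - 2 * \<Delta> 1"
    using sums_unique[OF sums_split_initial_segment[OF sy, of 2]] \<mu> \<nu>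
    by (simp add: y_eq numeral_2_eq_2 \<Delta>_def bessel_mag_0)
  ultimately have "\<bar>slope_at_1 \<nu> - slope_at_1 \<mu> - 2 * \<Delta> 1\<bar> \<le> 27 / 20 * \<Delta> 1" by simp
  then have "slope_at_1 \<nu> - slope_at_1 \<mu> - 2 * \<Delta> 1 \<le> 27 / 20 * \<Delta> 1"
    "- (27 / 20 * \<Delta> 1) \<le> slope_at_1 \<nu> - slope_at_1 \<mu> - 2 * \<Delta> 1"
    unfolding abs_le_iff by linarith+
  then show "13 / 20 * (bessel_mag \<mu> 1 - bessel_mag \<nu> 1) \<le> slope_at_1 \<nu> - slope_at_1 \<mu>"
    "slope_at_1 \<nu> - slope_at_1 \<mu> \<le> 67 / 20 * (bessel_mag \<mu> 1 - bessel_mag \<nu> 1)"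
    unfolding \<Delta>_def by linarith+
qed

lemma slope_at_1_strict_mono:
  assumes "0 < \<mu>" "\<mu> < \<nu>"
  shows "slope_at_1 \<mu> < slope_at_1 \<nu>"
proof -
  have "bessel_mag \<nu> 1 < bessel_mag \<mu> 1"
  proof -
    have "\<nu> * bessel_mag \<nu> 1 \<le> \<mu> * bessel_mag \<mu> 1"
      using scaled_bessel_mag_antimono[of \<mu> \<nu> 0] assms by simp
    also have "\<dots> < \<nu> * bessel_mag \<mu> 1"
      using assms by (intro mult_strict_right_mono bessel_mag_pos) auto
    finally show ?thesis using assms by simp
  qed
  then have "0 < 13 / 20 * (bessel_mag \<mu> 1 - bessel_mag \<nu> 1)" by simp
  with slope_at_1_increment(1)[OF assms(1) less_imp_le[OF assms(2)]] show ?thesis by linarith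
qed

lemma isCont_slope_at_1:
  assumes "x > 0"
  shows "isCont slope_at_1 x"
proof -
  have arith: "\<bar>e\<bar> \<le> 4 * \<bar>d\<bar>" if "13 / 20 * d \<le> e" "e \<le> 67 / 20 * d" "0 \<le> d" for d e :: real
    using that by linarith
  have bound: "\<bar>slope_at_1 y - slope_at_1 x\<bar> \<le> 4 * \<bar>bessel_mag y 1 - bessel_mag x 1\<bar>" if "y > 0" for y
  proof (cases "x \<le> y")
    case True
    show ?thesis
      using arith[OF slope_at_1_increment[OF assms True]] bessel_mag_antimono[OF assms True, of 1]
      by (simp add: abs_minus_commute)
  next
    case False
    then have "y \<le> x" by simp
    show ?thesis
      using arith[OF slope_at_1_increment[OF that \<open>y \<le> x\<close>]] bessel_mag_antimono[OF that \<open>y \<le> x\<close>, of 1]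
      by (simp add: abs_minus_commute)
  qed
  have pos: "\<forall>\<^sub>F y in nhds x. y \<in> {0<..}"
    using assms by (intro eventually_nhds_in_open) auto
  have "isCont (\<lambda>y. (2 + y) / (4 * y * (y + 1))) x"
    using assms by (intro continuous_intros) auto
  then have "((\<lambda>y. bessel_mag y 1) \<longlongrightarrow> bessel_mag x 1) (at x)"
    unfolding isCont_def bessel_mag_1[OF assms, symmetric]
    by (rule Lim_transform_eventually)
       (use pos in \<open>auto simp: eventually_at_filter bessel_mag_1[simplified] elim!: eventually_mono\<close>)
  then have "((\<lambda>y. 4 * \<bar>bessel_mag y 1 - bessel_mag x 1\<bar>) \<longlongrightarrow> 0) (at x)"
    by (auto intro!: tendsto_eq_intros)
  then have "((\<lambda>y. slope_at_1 y - slope_at_1 x) \<longlongrightarrow> 0) (at x)"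
    by (rule Lim_null_comparison[rotated])
       (use pos bound in \<open>auto simp: eventually_at_filter elim!: eventually_mono\<close>)
  then show ?thesis by (simp add: isCont_def LIM_zero_iff)
qed

lemma bessel_mag_numeral_simps:
  assumes "\<nu> > 0"
  shows "bessel_mag \<nu> 2 = mag_ratio \<nu> 1 * bessel_mag \<nu> 1"
    "bessel_mag \<nu> 3 = mag_ratio \<nu> 2 * bessel_mag \<nu> 2"
    "bessel_mag \<nu> 4 = mag_ratio \<nu> 3 * bessel_mag \<nu> 3"
  using bessel_mag_Suc[OF assms, of 1] bessel_mag_Suc[OF assms, of 2] bessel_mag_Suc[OF assms, of 3]
  by (simp_all add: numeral_eq_Suc)

lemma slope_at_1_neg: "slope_at_1 (7017 / 10000) < 0"
proof -
  define \<nu> :: real where "\<nu> = 7017 / 10000"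
  have \<nu>: "\<nu> > 0" by (simp add: \<nu>_def)
  have "(\<Sum>n<4. real (n + 1) * ((-1) ^ n * bessel_mag \<nu> n)) + 6 * bessel_mag \<nu> 4 < 0"
    using \<nu> by (simp add: lessThan_nat_numeral lessThan_Suc bessel_mag_numeral_simps bessel_mag_0)
      (simp add: bessel_mag_1[simplified] mag_ratio_def \<nu>_def)
  then show ?thesis using slope_at_1_approx[OF \<nu>] unfolding \<nu>_def by linarith
qed

lemma slope_at_1_pos: "0 < slope_at_1 (7027 / 10000)"
proof -
  define \<nu> :: real where "\<nu> = 7027 / 10000"
  have \<nu>: "\<nu> > 0" by (simp add: \<nu>_def)
  have "0 < (\<Sum>n<4. real (n + 1) * ((-1) ^ n * bessel_mag \<nu> n)) - 6 * bessel_mag \<nu> 4"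
    using \<nu> by (simp add: lessThan_nat_numeral lessThan_Suc bessel_mag_numeral_simps bessel_mag_0)
      (simp add: bessel_mag_1[simplified] mag_ratio_def \<nu>_def)
  then show ?thesis using slope_at_1_approx[OF \<nu>] unfolding \<nu>_def by linarith
qed

lemma slope_at_1_root:
  obtains \<nu>\<^sub>0 where "7017 / 10000 < \<nu>\<^sub>0" "\<nu>\<^sub>0 < 7027 / 10000" "slope_at_1 \<nu>\<^sub>0 = 0"
proof -
  obtain x where x: "7017 / 10000 \<le> x" "x \<le> 7027 / 10000" "slope_at_1 x = 0"
    using IVT[of slope_at_1 "7017 / 10000" 0 "7027 / 10000"] slope_at_1_neg slope_at_1_pos isCont_slope_at_1
    by force
  moreover have "x \<noteq> 7017 / 10000" "x \<noteq> 7027 / 10000"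
    using x(3) slope_at_1_neg slope_at_1_pos by (metis less_irrefl)+
  ultimately show ?thesis by (intro that[of x]) auto
qed

section \<open>Geometry of the Bessel derivative function\<close>

definition bessel_taylor :: "real \<Rightarrow> nat \<Rightarrow> complex" where
  "bessel_taylor \<nu> n = (case n of 0 \<Rightarrow> 0 | Suc m \<Rightarrow> of_real ((-1) ^ m * bessel_mag \<nu> m))"

lemma bessel_taylor_sums:
  assumes "\<nu> > 0"
  shows "(\<lambda>n. bessel_taylor \<nu> n * z ^ n) sums bessel_deriv_fun \<nu> z"
proof -
  have "(\<lambda>n. bessel_taylor \<nu> (Suc n) * z ^ Suc n) sums bessel_deriv_fun \<nu> z"
    using bessel_deriv_fun_sums[OF assms, of z] by (simp add: bessel_taylor_def bessel_mag_def mult_ac)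
  from sums_Suc[OF this] show ?thesis by (simp add: bessel_taylor_def)
qed

lemma bessel_taylor_summable:
  "\<nu> > 0 \<Longrightarrow> summable (\<lambda>n. bessel_taylor \<nu> n * z ^ n)"
  using bessel_taylor_sums sums_summable by blast

lemma bessel_deriv_fun_eq_power_series:
  "\<nu> > 0 \<Longrightarrow> bessel_deriv_fun \<nu> = (\<lambda>z. \<Sum>n. bessel_taylor \<nu> n * z ^ n)"
  using bessel_taylor_sums by (auto simp: sums_iff)

lemma diffs_bessel_taylor:
  "diffs (bessel_taylor \<nu>) n = of_real (real (n + 1) * ((-1) ^ n * bessel_mag \<nu> n))"
  by (simp add: diffs_def bessel_taylor_def)

lemma bessel_deriv_fun_has_derivative:
  assumes "\<nu> > 0"
  shows "(bessel_deriv_fun \<nu> has_field_derivative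
    (\<Sum>n. of_real (real (n + 1) * ((-1) ^ n * bessel_mag \<nu> n)) * z ^ n)) (at z)"
  using termdiffs_strong_converges_everywhere[OF bessel_taylor_summable[OF assms], of z]
  unfolding bessel_deriv_fun_eq_power_series[OF assms, symmetric] diffs_bessel_taylor .

lemma bessel_deriv_fun_quotient_series:
  assumes "\<nu> > 0"
  shows "bessel_deriv_fun \<nu> z = z * (\<Sum>n. of_real ((-1) ^ n * bessel_mag \<nu> n) * z ^ n)"
proof (cases "z = 0")
  case True
  then show ?thesis by (simp add: bessel_deriv_fun_def)
next
  case False
  have "(\<lambda>n. bessel_taylor \<nu> (Suc n) * z ^ Suc n) sums bessel_deriv_fun \<nu> z"
    using bessel_taylor_sums[OF assms, of z]
    by (subst sums_Suc_iff) (simp add: bessel_taylor_def)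
  from sums_divide[OF this, of z] False
  have "(\<lambda>n. of_real ((-1) ^ n * bessel_mag \<nu> n) * z ^ n) sums (bessel_deriv_fun \<nu> z / z)"
    by (simp add: bessel_taylor_def mult_ac)
  then show ?thesis using False by (simp add: sums_iff)
qed

lemma starlike_if_slope_nonneg:
  assumes \<nu>: "\<nu> > 0" and slope: "0 \<le> slope_at_1 \<nu>"
  shows "starlike_fun (bessel_deriv_fun \<nu>)"
proof -
  obtain T where T: "(\<lambda>n. (real (n + 2))\<^sup>2 * (real (n + 3) * bessel_mag \<nu> (n + 2))) sums T"
    "T < 2 * bessel_mag \<nu> 1"
    using bessel_mag_second_moment[OF \<nu>] .
  show ?thesis
  proof (rule starlike_if_linear_term_dominates[where a = "\<lambda>n. (-1) ^ n * bessel_mag \<nu> n" and T = T])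
    show "(\<lambda>n. (real (n + 2))\<^sup>2 * (real (n + 3) * \<bar>(-1) ^ (n + 2) * bessel_mag \<nu> (n + 2)\<bar>)) sums T"
      using T(1) bessel_mag_pos[OF \<nu>] by (simp add: abs_mult power_abs less_imp_le)
  qed (use T(2) slope in \<open>simp_all add: bessel_deriv_fun_quotient_series[OF \<nu>]
        bessel_deriv_fun_has_derivative[OF \<nu>, simplified] slope_at_1_def\<close>)
qed

lemma not_inj_if_slope_neg:
  assumes \<nu>: "\<nu> > 0" and slope: "slope_at_1 \<nu> < 0"
  shows "\<not> inj_on (bessel_deriv_fun \<nu>) \<D>"
proof
  assume inj: "inj_on (bessel_deriv_fun \<nu>) \<D>"
  define c where "c = (\<lambda>n. real (n + 1) * ((-1) ^ n * bessel_mag \<nu> n))"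
  define r where "r = (\<lambda>x. \<Sum>n. c n * x ^ n)"
  have "summable (\<lambda>n. diffs (bessel_taylor \<nu>) n * z ^ n)" for z
    by (rule termdiff_converges_all[OF bessel_taylor_summable[OF \<nu>]])
  from this[of "of_real x" for x] have "summable (\<lambda>n. of_real (c n * x ^ n) :: complex)" for x
    by (simp add: diffs_bessel_taylor c_def)
  then have sc: "summable (\<lambda>n. c n * x ^ n)" for x
    by (simp only: summable_complex_of_real)
  have "isCont r x" for x
    unfolding r_def by (rule DERIV_isCont[OF termdiffs_strong_converges_everywhere[OF sc]])
  moreover have "r 0 = 1" using bessel_mag_0[OF \<nu>] by (simp add: r_def c_def powser_zero)
  moreover have "r 1 = slope_at_1 \<nu>" by (simp add: r_def c_def slope_at_1_def)
  ultimately obtain x where x: "0 \<le> x" "x \<le> 1" "r x = 0"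
    using IVT2[of r 1 0 0] slope by force
  with slope \<open>r 1 = _\<close> have "x < 1" by (cases "x = 1") auto
  have "deriv (bessel_deriv_fun \<nu>) (of_real x) = (\<Sum>n. of_real (c n * x ^ n))"
    unfolding DERIV_imp_deriv[OF bessel_deriv_fun_has_derivative[OF \<nu>]] c_def by simp
  also have "\<dots> = of_real (r x)" unfolding r_def by (rule suminf_of_real[OF sc, symmetric])
  finally have "deriv (bessel_deriv_fun \<nu>) (of_real x) = 0" using x by simp
  moreover have "bessel_deriv_fun \<nu> holomorphic_on \<D>"
    using bessel_deriv_fun_has_derivative[OF \<nu>]
    by (meson holomorphic_onI has_field_derivative_at_within field_differentiable_def)
  ultimately show False
    using holomorphic_injective_imp_regular[OF _ open_ball inj, of "of_real x"] x \<open>x < 1\<close> by simp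
qed

text \<open>
  Differentiating \<open>k + 1\<close> times multiplies the ratio of the coefficients with index \<open>m\<close> and \<open>m + 1\<close>,
  where \<open>m = n + k \<ge> 1\<close>, by \<open>(m + 2) / (n + 1)\<close>.  The ratio was at most \<open>1 / (4 * m * (m + 1))\<close>, and
  \<open>(m + 2) / (4 * m * (m + 1)) \<le> 3/8\<close> with equality for \<open>m = 1\<close>.
\<close>

lemma bessel_taylor_diffs_decay:
  assumes \<nu>: "\<nu> > 0" and k: "k \<ge> 1"
  defines "d \<equiv> (diffs ^^ Suc k) (bessel_taylor \<nu>)"
  shows "d 0 \<noteq> 0" and "norm (d (Suc n)) \<le> 3 / 8 * norm (d n)"
proof -
  have nd: "norm (d n) = pochhammer (real (Suc n)) (Suc k) * bessel_mag \<nu> (n + k)" for n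
  proof -
    have "d n = of_real (pochhammer (real (Suc n)) (Suc k) * ((-1) ^ (n + k) * bessel_mag \<nu> (n + k)))"
      unfolding d_def diffs_funpow by (simp add: bessel_taylor_def pochhammer_of_real[symmetric] del: pochhammer_Suc of_nat_Suc)
    also have "norm \<dots> = pochhammer (real (Suc n)) (Suc k) * bessel_mag \<nu> (n + k)"
      unfolding norm_of_real using bessel_mag_pos[OF \<nu>, of "n + k"] pochhammer_pos[of "real (Suc n)" "Suc k"]
      by (simp add: abs_mult power_abs)
    finally show ?thesis .
  qed
  show "d 0 \<noteq> 0"
    using nd[of 0] bessel_mag_pos[OF \<nu>, of "0 + k"] pochhammer_pos[of "real (Suc 0)" "Suc k"]
    by (metis mult_pos_pos less_irrefl norm_zero of_nat_0_less_iff zero_less_Suc)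
  define m where "m = n + k"
  have m: "m \<ge> 1" "n \<le> m" using k by (auto simp: m_def)
  define w where "w = pochhammer (real (Suc n)) (Suc k)"
  define w' where "w' = pochhammer (real (Suc (Suc n))) (Suc k)"
  have w_pos: "w > 0" "w' > 0" by (auto simp: w_def w'_def intro!: pochhammer_pos)
  have "pochhammer (real (Suc n)) (Suc (Suc k)) = real (Suc n) * w'"
    unfolding w'_def by (subst pochhammer_rec) (simp add: add_ac)
  moreover have "pochhammer (real (Suc n)) (Suc (Suc k)) = w * (real m + 2)"
    unfolding w_def by (subst pochhammer_Suc) (simp add: m_def add_ac)
  ultimately have w': "real (Suc n) * w' = w * (real m + 2)" by simp
  have "w' \<le> real (Suc n) * w'" using w_pos by simp
  also have "\<dots> \<le> w * (3 / 8 * (4 * real m * (real m + 1)))"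
    unfolding w' using w_pos(1)
  proof (intro mult_left_mono)
    have "1 * real m \<le> real m * real m" using m by (intro mult_right_mono) auto
    moreover have "1 \<le> real m" using m by simp
    ultimately show "real m + 2 \<le> 3 / 8 * (4 * real m * (real m + 1))"
      unfolding distrib_left by linarith
  qed simp
  finally have "w' \<le> 3 / 8 * w * (4 * real m * (real m + 1))" by (simp add: mult_ac)
  from weighted_mag_decay[OF \<nu> m(1) less_imp_le[OF w_pos(2)] this]
  show "norm (d (Suc n)) \<le> 3 / 8 * norm (d n)"
    unfolding nd by (simp add: w_def w'_def m_def)
qed

lemma higher_deriv_bounded_turning:
  assumes \<nu>: "\<nu> > 0" and k: "k \<ge> 1"
  obtains h' c where "c \<noteq> 0"
    and "\<And>z. ((deriv ^^ k) (bessel_deriv_fun \<nu>) has_field_derivative h' z) (at z)"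
    and "\<And>z. z \<in> \<D> \<Longrightarrow> 0 < Re (h' z / c)"
proof -
  define d where "d = (diffs ^^ Suc k) (bessel_taylor \<nu>)"
  note decay = bessel_taylor_diffs_decay[OF \<nu> k, folded d_def]
  note ps = summable_diffs_funpow[OF bessel_taylor_summable[OF \<nu>]]
    deriv_funpow_power_series[OF bessel_taylor_summable[OF \<nu>]]
  have "((deriv ^^ k) (bessel_deriv_fun \<nu>) has_field_derivative (\<Sum>n. d n * z ^ n)) (at z)" for z
    unfolding bessel_deriv_fun_eq_power_series[OF \<nu>] ps(2) d_def funpow.simps o_apply
    by (rule termdiffs_strong_converges_everywhere[OF ps(1)])
  moreover have "0 < Re ((\<Sum>n. d n * z ^ n) / d 0)" if "z \<in> \<D>" for z
    using that by (intro Re_power_series_quotient_pos[where q = "3 / 8"] decay) auto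
  ultimately show ?thesis by (rule that[OF decay(1)])
qed

text \<open>
  With \<open>u n\<close> the terms of the series of \<open>J_\<nu>(1)\<close> up to the factor \<open>2 powr (-\<nu>)\<close>, both Bessel values
  are combinations of \<open>S0 = (\<Sum>n. u n)\<close> and \<open>S1 = (\<Sum>n. n * u n)\<close>.  The series of \<open>slope_at_1 \<nu>\<close> contains
  also \<open>n^2 * u n\<close>, which Bessel's equation removes.
\<close>

lemma bessel_equation_iff_slope_zero:
  assumes \<nu>: "\<nu> > 0"
  shows "of_real (2 * \<nu> - 1) * bessel_J \<nu> 1 + of_real (\<nu> - 2) * bessel_J (\<nu> + 1) 1 = 0
    \<longleftrightarrow> slope_at_1 \<nu> = 0"
proof -
  define u where "u = (\<lambda>n. bessel_coeff \<nu> n * (1 / 4) ^ n)"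
  define S0 where "S0 = (\<Sum>n. u n)"
  define S1 where "S1 = (\<Sum>n. of_nat n * u n)"
  define b :: complex where "b = (1 / 2) powr of_real \<nu>"
  have b: "b \<noteq> 0" by (simp add: b_def)
  have su: "u sums S0"
    unfolding S0_def u_def by (intro summable_sums summable_bessel_coeff \<nu>)
  have "bessel_coeff (\<nu> + 1) n = - (of_nat (n + 1) * bessel_coeff \<nu> (n + 1))" for n
    by (simp add: bessel_coeff_def add_ac del: of_nat_Suc) (simp add: field_simps)
  then have shift: "bessel_coeff (\<nu> + 1) n * (1 / 4) ^ n = - 4 * (of_nat (Suc n) * u (Suc n))" for n
    by (simp add: u_def)
  have J0: "bessel_J \<nu> 1 = b * S0"
    using bessel_J_eq[OF \<nu>, of 1] by (simp add: b_def S0_def u_def power2_eq_square)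
  have s1: "summable (\<lambda>n. of_nat (Suc n) * u (Suc n))"
  proof -
    have "summable (\<lambda>n. bessel_coeff (\<nu> + 1) n * (1 / 4) ^ n)"
      by (rule summable_bessel_coeff) (use \<nu> in simp)
    then show ?thesis
      unfolding shift by (subst (asm) summable_cmult_iff) simp
  qed
  then have su1: "(\<lambda>n. of_nat n * u n) sums S1"
    unfolding S1_def by (intro summable_sums) (subst (asm) summable_Suc_iff)
  have J1: "bessel_J (\<nu> + 1) 1 = b * (- 2 * S1)"
  proof -
    have "(\<Sum>n. of_nat (Suc n) * u (Suc n)) = S1"
      using suminf_split_head[OF sums_summable[OF su1]] by (simp add: S1_def)
    then have "(\<Sum>n. bessel_coeff (\<nu> + 1) n * (1 / 4) ^ n) = - 4 * S1"
      unfolding shift using suminf_mult[OF s1, of "- 4"] by simp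
    moreover have "(1 / 2 :: complex) powr of_real (\<nu> + 1) = b / 2"
      by (simp add: b_def powr_add)
    moreover have "bessel_J (\<nu> + 1) 1
        = (1 / 2) powr of_real (\<nu> + 1) * (\<Sum>n. bessel_coeff (\<nu> + 1) n * (1 / 4) ^ n)"
      using bessel_J_eq[of "\<nu> + 1" 1] \<nu> by (simp add: power2_eq_square)
    ultimately show ?thesis by (simp only:) simp
  qed
  \<comment> \<open>Bessel's equation at the level of coefficients.\<close>
  have "4 * of_nat (Suc n) * of_real (real (Suc n) + \<nu>) * u (Suc n) = - u n" for n
  proof -
    have "of_real ((real n + 1) * (real n + \<nu> + 1)) \<noteq> (0::complex)"
      using \<nu> by (simp only: of_real_eq_0_iff) auto
    then have "of_real ((real n + 1) * (real n + \<nu> + 1)) * bessel_coeff \<nu> (Suc n) = - bessel_coeff \<nu> n"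
      by (simp add: bessel_coeff_Suc[OF \<nu>] del: of_real_mult of_real_add)
    moreover have "4 * of_nat (Suc n) * of_real (real (Suc n) + \<nu>) * u (Suc n)
        = of_real ((real n + 1) * (real n + \<nu> + 1)) * bessel_coeff \<nu> (Suc n) * (1 / 4) ^ n"
      by (simp add: u_def algebra_simps)
    ultimately show ?thesis by (simp add: u_def)
  qed
  then have "(\<lambda>n. 4 * of_nat (Suc n) * of_real (real (Suc n) + \<nu>) * u (Suc n)) sums (- S0)"
    using sums_minus[OF su] by simp
  from sums_Suc[OF this]
  have ode: "(\<lambda>n. 4 * of_nat n * of_real (real n + \<nu>) * u n) sums (- S0)" by simp
  have "(\<lambda>n. 4 * of_nat n * of_real (real n + \<nu>) * u n + of_real (4 - 2 * \<nu>) * (of_nat n * u n)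
      + of_real (2 * \<nu>) * u n) sums (- S0 + of_real (4 - 2 * \<nu>) * S1 + of_real (2 * \<nu>) * S0)"
    by (intro sums_add ode sums_mult su su1)
  moreover have "4 * of_nat n * of_real (real n + \<nu>) * u n + of_real (4 - 2 * \<nu>) * (of_nat n * u n)
      + of_real (2 * \<nu>) * u n = of_real (2 / Gamma \<nu>) * of_real (real (n + 1) * ((-1) ^ n * bessel_mag \<nu> n))" for n
  proof -
    have "Gamma \<nu> \<noteq> 0" using Gamma_real_pos[OF \<nu>] by simp
    then have mag: "of_real ((-1) ^ n * bessel_mag \<nu> n) = of_real (Gamma \<nu>) * of_real (2 * real n + \<nu>) * u n"
      by (simp add: u_def bessel_mag_def bessel_coeff_def power_divide mult_ac)
    show ?thesis
      unfolding of_real_mult[of "real (n + 1)"] mag using \<open>Gamma \<nu> \<noteq> 0\<close> by (simp add: algebra_simps)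
  qed
  moreover have "(\<lambda>n. of_real (2 / Gamma \<nu>) * of_real (real (n + 1) * ((-1) ^ n * bessel_mag \<nu> n)))
      sums (of_real (2 / Gamma \<nu>) * of_real (slope_at_1 \<nu>) :: complex)"
    unfolding slope_at_1_def
    by (intro sums_mult sums_of_real summable_sums slope_terms_summable \<nu>)
  ultimately have "- S0 + of_real (4 - 2 * \<nu>) * S1 + of_real (2 * \<nu>) * S0
      = of_real (2 / Gamma \<nu>) * of_real (slope_at_1 \<nu>)"
    by (simp add: sums_iff)
  moreover have "of_real (2 * \<nu> - 1) * bessel_J \<nu> 1 + of_real (\<nu> - 2) * bessel_J (\<nu> + 1) 1
      = b * (- S0 + of_real (4 - 2 * \<nu>) * S1 + of_real (2 * \<nu>) * S0)"
    unfolding J0 J1 by (simp add: algebra_simps)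
  ultimately have "of_real (2 * \<nu> - 1) * bessel_J \<nu> 1 + of_real (\<nu> - 2) * bessel_J (\<nu> + 1) 1
      = b * of_real (2 / Gamma \<nu>) * of_real (slope_at_1 \<nu>)"
    by (simp only: mult.assoc)
  then show ?thesis using b Gamma_real_pos[OF \<nu>] by simp
qed

theorem theorem3:
  shows "\<exists>\<nu>\<^sub>0::real.
      0 < \<nu>\<^sub>0
    \<and> (\<forall>\<nu>::real. 0 < \<nu> \<longrightarrow>
         of_real (2 * \<nu> - 1) * bessel_J \<nu> 1 + of_real (\<nu> - 2) * bessel_J (\<nu> + 1) 1 = 0
           \<longleftrightarrow> \<nu> = \<nu>\<^sub>0)
    \<and> \<bar>\<nu>\<^sub>0 - 7022 / 10 ^ 4\<bar> < 5 / 10 ^ 4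
    \<and> (\<forall>\<nu>::real. 0 < \<nu> \<longrightarrow>
         (starlike_fun (bessel_deriv_fun \<nu>)
            \<and> (\<forall>k\<ge>1. close_to_convex ((deriv ^^ k) (bessel_deriv_fun \<nu>))))
           \<longleftrightarrow> \<nu>\<^sub>0 \<le> \<nu>)
    \<and> (\<forall>\<nu>::real. \<nu>\<^sub>0 \<le> \<nu> \<longrightarrow>
         (\<forall>k\<ge>1. inj_on ((deriv ^^ k) (bessel_deriv_fun \<nu>)) \<D>))"
proof -
  obtain \<nu>\<^sub>0 where \<nu>\<^sub>0: "7017 / 10000 < \<nu>\<^sub>0" "\<nu>\<^sub>0 < 7027 / 10000" "slope_at_1 \<nu>\<^sub>0 = 0"
    using slope_at_1_root .
  have pos: "0 < \<nu>\<^sub>0" using \<nu>\<^sub>0 by simp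
  have zero: "slope_at_1 \<nu> = 0 \<longleftrightarrow> \<nu> = \<nu>\<^sub>0" and nonneg: "0 \<le> slope_at_1 \<nu> \<longleftrightarrow> \<nu>\<^sub>0 \<le> \<nu>" if "0 < \<nu>" for \<nu>
    using slope_at_1_strict_mono[of \<nu> \<nu>\<^sub>0] slope_at_1_strict_mono[of \<nu>\<^sub>0 \<nu>] that pos \<nu>\<^sub>0(3)
    by (cases \<nu> \<nu>\<^sub>0 rule: linorder_cases; simp)+
  have ctc: "close_to_convex ((deriv ^^ k) (bessel_deriv_fun \<nu>))"
    and inj: "inj_on ((deriv ^^ k) (bessel_deriv_fun \<nu>)) \<D>" if "0 < \<nu>" "k \<ge> 1" for \<nu> k
  proof -
    obtain h' c where h': "c \<noteq> 0"
      "\<And>z. ((deriv ^^ k) (bessel_deriv_fun \<nu>) has_field_derivative h' z) (at z)"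
      "\<And>z. z \<in> \<D> \<Longrightarrow> 0 < Re (h' z / c)"
      using higher_deriv_bounded_turning[OF \<open>0 < \<nu>\<close> \<open>k \<ge> 1\<close>] by metis
    show "close_to_convex ((deriv ^^ k) (bessel_deriv_fun \<nu>))"
      by (rule close_to_convex_linear[OF h'(2) h'(1,3)])
    show "inj_on ((deriv ^^ k) (bessel_deriv_fun \<nu>)) \<D>"
      by (rule noshiro_warschawski[OF convex_ball h'(2,3)])
  qed
  have starlike: "starlike_fun (bessel_deriv_fun \<nu>) \<longleftrightarrow> \<nu>\<^sub>0 \<le> \<nu>" if "0 < \<nu>" for \<nu>
    using starlike_if_slope_nonneg[OF that] not_inj_if_slope_neg[OF that] nonneg[OF that]
    by (auto simp: starlike_fun_def not_le)
  show ?thesis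
  proof (intro exI[of _ \<nu>\<^sub>0] conjI allI impI)
    show "\<bar>\<nu>\<^sub>0 - 7022 / 10 ^ 4\<bar> < 5 / 10 ^ 4" using \<nu>\<^sub>0 unfolding abs_less_iff by simp
  qed (use pos bessel_equation_iff_slope_zero zero starlike ctc inj in \<open>auto intro: less_le_trans[OF pos]\<close>)
qed

end
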